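(* Let $F_n=f_1\cdots f_n$ be a composition sequence generated by a finite subcollection $\mathcal{F}$ of $\mathcal{M}(\mathbb{D})$. Then $(F_n)$ converges ideally to a point $q\in\overline{\mathbb{D}}$. Moreover, $(F_n)$ converges locally uniformly to $q$ on $\overline{\mathbb{D}}\setminus X$, where $$X=\{\alpha_f\in\partial\mathbb{D}: f\in\mathcal{F},\ f_n=f\text{ for infinitely many }n\}.$$ Finally, for each $x\in X$, the sequence $(F_n(x))$ converges to $q$ if and only if $(F_n)$ is of limit-point type.
   Context: $\mathbb{D}$ is the open unit disc; $\mathcal{M}(\mathbb{D})$ is the set of Möbius transformations $f$ with $f(\mathbb{D})\subset\mathbb{D}$, $f(\mathbb{D})\neq\mathbb{D}$. For $f\in\mathcal{M}(\mathbb{D})$: if $f(\mathbb{D})$ is internally tangent to $\mathbb{D}$ (at a unique point), $\alpha_f\in\partial\mathbb{D}$ is the unique point with $f(\alpha_f)\in\partial\mathbb{D}$; otherwise $\alpha_f=0$ (so such $f$ contribute nothing to $X$). The composition sequence is of limit-point type if $\bigcap_n F_n(\overline{\mathbb{D}})$ is a single point. Möbius maps act on $\mathbb{H}^3=\{(x,y,t):t>0\}$ (upper half-space, with $\overline{\mathbb{C}}$ as ideal boundary) via Poincaré extension; $j=(0,0,1)$. A sequence $(F_n)$ with $\rho(j,F_n(j))\to\infty$ ($\rho$ the hyperbolic metric) converges ideally to $p\in\overline{\mathbb{C}}$ if $F_n(j)\to p$ in the chordal metric. Locally uniform convergence is with respect to the chordal metric. *)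

theory Defs
  imports "HOL-Analysis.Analysis"
begin

text \<open>A Moebius transformation z \<mapsto> (a z + b)/(c z + d) is represented by its
  coefficient quadruple (a,b,c,d) with a d - b c \<noteq> 0.\<close>
type_synonym moeb = "complex \<times> complex \<times> complex \<times> complex"

definition moeb_ok :: "moeb \<Rightarrow> bool" where
  "moeb_ok m = (case m of (a,b,c,d) \<Rightarrow> a*d - b*c \<noteq> 0)"

text \<open>Action on finite points of the Riemann sphere (only used away from the pole).\<close>
definition moeb_app :: "moeb \<Rightarrow> complex \<Rightarrow> complex" where
  "moeb_app m z = (case m of (a,b,c,d) \<Rightarrow> (a*z + b) / (c*z + d))"

definition MD :: "moeb set" where
  "MD = {m. moeb_ok m \<and>
            (\<forall>z\<in>ball 0 1. (case m of (a,b,c,d) \<Rightarrow> c*z + d \<noteq> 0) \<and> moeb_app m z \<in> ball 0 1) \<and>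
            moeb_app m ` ball 0 1 \<noteq> ball 0 1}"

text \<open>alpha_f: the unique boundary point sent to the boundary if f(D) is internally
  tangent to D, and 0 otherwise.\<close>
definition alpha :: "moeb \<Rightarrow> complex" where
  "alpha m = (if \<exists>!w. w \<in> sphere 0 1 \<and> moeb_app m w \<in> sphere 0 1
              then (THE w. w \<in> sphere 0 1 \<and> moeb_app m w \<in> sphere 0 1) else 0)"

text \<open>Upper half-space H^3 = {(x,y,t). t > 0}, points written as (x + i y, t).
  Poincare extension of (a,b,c,d) (formula valid for any nonzero determinant).\<close>
definition poinc :: "moeb \<Rightarrow> complex \<times> real \<Rightarrow> complex \<times> real" where
  "poinc m p = (case m of (a,b,c,d) \<Rightarrow> case p of (z,t) \<Rightarrow>
     let D = (cmod (c*z + d))\<^sup>2 + (cmod c)\<^sup>2 * t\<^sup>2 in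
     (((a*z + b) * cnj (c*z + d) + a * cnj c * complex_of_real (t\<^sup>2)) / complex_of_real D,
      cmod (a*d - b*c) * t / D))"

definition jpt :: "complex \<times> real" where "jpt = (0, 1)"

definition hdist :: "complex \<times> real \<Rightarrow> complex \<times> real \<Rightarrow> real" where
  "hdist p q = (case p of (z,t) \<Rightarrow> case q of (w,s) \<Rightarrow>
     arcosh (1 + ((cmod (z - w))\<^sup>2 + (t - s)\<^sup>2) / (2 * t * s)))"

definition chordal :: "complex \<Rightarrow> complex \<Rightarrow> real" where
  "chordal z w = 2 * cmod (z - w) / sqrt ((1 + (cmod z)\<^sup>2) * (1 + (cmod w)\<^sup>2))"

definition chordal3 :: "complex \<times> real \<Rightarrow> complex \<times> real \<Rightarrow> real" where
  "chordal3 p q = (case p of (z,t) \<Rightarrow> case q of (w,s) \<Rightarrow>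
     2 * sqrt ((cmod (z - w))\<^sup>2 + (t - s)\<^sup>2) /
       sqrt ((1 + (cmod z)\<^sup>2 + t\<^sup>2) * (1 + (cmod w)\<^sup>2 + s\<^sup>2)))"

fun compseq :: "('m \<Rightarrow> 'a \<Rightarrow> 'a) \<Rightarrow> (nat \<Rightarrow> 'm) \<Rightarrow> nat \<Rightarrow> 'a \<Rightarrow> 'a" where
  "compseq act f 0 = id"
| "compseq act f (Suc n) = compseq act f n \<circ> act (f (Suc n))"

definition conv_ideally :: "(nat \<Rightarrow> complex \<times> real \<Rightarrow> complex \<times> real) \<Rightarrow> complex \<Rightarrow> bool" where
  "conv_ideally G p \<longleftrightarrow> filterlim (\<lambda>n. hdist jpt (G n jpt)) at_top sequentially \<and>
     ((\<lambda>n. chordal3 (G n jpt) (p, 0)) \<longlongrightarrow> 0) sequentially"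

definition loc_unif_chordal :: "(nat \<Rightarrow> complex \<Rightarrow> complex) \<Rightarrow> complex \<Rightarrow> complex set \<Rightarrow> bool" where
  "loc_unif_chordal G q S \<longleftrightarrow> (\<forall>x\<in>S. \<exists>e>0. \<forall>\<epsilon>>0. \<exists>N. \<forall>n\<ge>N. \<forall>z\<in>S \<inter> ball x e.
     chordal (G n z) q < \<epsilon>)"

definition limit_point_type :: "(nat \<Rightarrow> complex \<Rightarrow> complex) \<Rightarrow> bool" where
  "limit_point_type G \<longleftrightarrow> (\<exists>p. (\<Inter>n. G n ` cball 0 1) = {p})"

end

theory Submission
  imports Defs
begin

text \<open>The discs \<open>F\<^sub>n(cball 0 1)\<close> are nested, and if their intersection is a point everything is
  uniform. Otherwise only finitely many blocks \<open>f\<^sub>n \<circ> f\<^sub>n\<^sub>+\<^sub>1\<close> map the closed disc into the open disc,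
  since each such block shrinks the diameter by a fixed factor. Hence, from some index on, every
  \<open>f\<^sub>n\<close> is tangent and \<open>f\<^sub>n\<^sub>+\<^sub>1\<close> sends its tangency point to that of \<open>f\<^sub>n\<close>. Moving the tangency points to
  infinity turns the tail of the composition sequence into affine self-maps
  \<open>w \<mapsto> \<kappa>\<^sub>k w + \<mu>\<^sub>k\<close> of the right half-plane, where the increments of \<open>\<mu>\<^sub>k\<close> are comparable to
  \<open>\<kappa>\<^sub>k\<close>. As the discs do not shrink to a point, \<open>Re \<mu>\<^sub>k\<close> is bounded, so \<open>\<kappa>\<^sub>k\<close> is summable and the
  maps converge to a finite constant away from the tangency points, while these points are
  sent to infinity.\<close>

section \<open>Pole-free Moebius maps and the Cayley transform\<close>

text \<open>A single tangent map never sends the closed disc into the open one, so contraction can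
  only be read off from two consecutive maps. If the composite of two still touches the unit circle,
  their tangency points must match. Finiteness of \<open>\<F>\<close> supplies the uniform
  constants. There are finitely many pairs, so one radius below 1 serves all contracting blocks; and
  finitely many translation parts, so the increments of \<open>\<mu>\<close> lie between fixed
  multiples of \<open>\<kappa>\<close>. The lower multiple is positive because the image of each map
  is a proper part of the disc. The tangency points vary with the index, so no single conjugation
  makes all maps affine. Each map gets separate Cayley transforms at source and target, and the
  matching condition makes the conjugates compose. The exceptional point moves as well: uniform
  convergence is proved off a neighbourhood of the moving point, and carried over to the complement
  of \<open>X\<close> once every map still occurring recurs forever. Ideal convergence is reduced to
  the action on the disc by placing \<open>j\<close> on a geodesic with antipodal endpoints outside
  \<open>X\<close>.\<close>

definition moeb_den :: "moeb \<Rightarrow> complex \<Rightarrow> complex" where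
  "moeb_den m z = (case m of (a,b,c,d) \<Rightarrow> c*z + d)"

definition moeb_det :: "moeb \<Rightarrow> complex" where
  "moeb_det m = (case m of (a,b,c,d) \<Rightarrow> a*d - b*c)"

definition moeb_mul :: "moeb \<Rightarrow> moeb \<Rightarrow> moeb" where
  "moeb_mul m m' = (case m of (a,b,c,d) \<Rightarrow> case m' of (a',b',c',d') \<Rightarrow>
     (a*a' + b*c', a*b' + b*d', c*a' + d*c', c*b' + d*d'))"

text \<open>\<open>moeb_app\<close> returns the junk value 0 at a pole, where coefficient products
  need not match composition of functions. Excluding poles on the whole closed disc makes the two
  agree there.\<close>

definition pole_free :: "moeb \<Rightarrow> bool" where
  "pole_free m \<longleftrightarrow> moeb_det m \<noteq> 0 \<and> (\<forall>z\<in>cball 0 1. moeb_den m z \<noteq> 0)"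

lemma moeb_det_mul: "moeb_det (moeb_mul m m') = moeb_det m * moeb_det m'"
  by (auto simp: moeb_det_def moeb_mul_def algebra_simps split: prod.splits)

lemma moeb_den_mul:
  assumes "moeb_den m' z \<noteq> 0"
  shows "moeb_den (moeb_mul m m') z = moeb_den m (moeb_app m' z) * moeb_den m' z"
  using assms
  by (auto simp: moeb_den_def moeb_mul_def moeb_app_def field_simps split: prod.splits)

lemma moeb_app_mul:
  assumes "moeb_den m' z \<noteq> 0" "moeb_den m (moeb_app m' z) \<noteq> 0"
  shows "moeb_app (moeb_mul m m') z = moeb_app m (moeb_app m' z)"
proof -
  obtain a b c d where m: "m = (a,b,c,d)" by (metis prod_cases4)
  obtain a' b' c' d' where m': "m' = (a',b',c',d')" by (metis prod_cases4)
  have v: "c'*z + d' \<noteq> 0" using assms by (simp add: m' moeb_den_def)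
  define w where "w = (a'*z + b') / (c'*z + d')"
  have ww: "a'*z + b' = w * (c'*z + d')" using v by (simp add: w_def)
  have "moeb_app (moeb_mul m m') z
      = (a * (a'*z+b') + b * (c'*z+d')) / (c * (a'*z+b') + d * (c'*z+d'))"
    by (simp add: m m' moeb_app_def moeb_mul_def algebra_simps)
  also have "\<dots> = ((a*w + b) * (c'*z+d')) / ((c*w + d) * (c'*z+d'))"
    unfolding ww by (simp add: algebra_simps)
  also have "\<dots> = (a*w + b) / (c*w + d)" using v by simp
  finally show ?thesis by (simp add: m m' moeb_app_def w_def)
qed

text \<open>The common source of injectivity, of the affine form under Cayley transforms, of the
  contraction estimate and of the height formula for the Poincare extension.\<close>

lemma moeb_app_diff:
  assumes "moeb_den m z \<noteq> 0" "moeb_den m w \<noteq> 0"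
  shows "moeb_app m z - moeb_app m w = moeb_det m * (z - w) / (moeb_den m z * moeb_den m w)"
proof -
  obtain a b c d where m: "m = (a,b,c,d)" by (metis prod_cases4)
  show ?thesis using assms
    by (simp add: m moeb_app_def moeb_den_def moeb_det_def diff_frac_eq) (simp add: algebra_simps)
qed

lemma pole_free_inj_on: "pole_free m \<Longrightarrow> inj_on (moeb_app m) (cball 0 1)"
proof (rule inj_onI)
  fix z w assume "pole_free m" "z \<in> cball 0 1" "w \<in> cball 0 1" "moeb_app m z = moeb_app m w"
  then show "z = w" using moeb_app_diff[of m z w] by (auto simp: pole_free_def)
qed

lemma pole_free_continuous_on: "pole_free m \<Longrightarrow> continuous_on (cball 0 1) (moeb_app m)"
  by (cases m) (auto simp: pole_free_def moeb_app_def moeb_den_def intro!: continuous_intros)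

lemma MD_maps_ball: "m \<in> MD \<Longrightarrow> z \<in> ball 0 1 \<Longrightarrow> moeb_app m z \<in> ball 0 1"
  by (simp add: MD_def)

text \<open>\<open>MD\<close> constrains only the open disc. The inequality
  \<open>cmod (a*z+b) \<le> cmod (c*z+d)\<close> is a closed condition, so it passes to the
  boundary; at a boundary pole it would make the numerator vanish too, contradicting the nonzero
  determinant.\<close>

lemma MD_pole_free_and_maps:
  assumes "m \<in> MD"
  shows "pole_free m" "\<And>z. z \<in> cball 0 1 \<Longrightarrow> moeb_app m z \<in> cball 0 1"
proof -
  obtain a b c d where m: "m = (a,b,c,d)" by (metis prod_cases4)
  have det: "a*d - b*c \<noteq> 0" using assms by (simp add: MD_def moeb_ok_def m)
  have in_ball: "c*z+d \<noteq> 0" "cmod ((a*z+b)/(c*z+d)) < 1" if "z \<in> ball 0 1" for z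
    using assms that by (auto simp: MD_def m moeb_app_def)
  let ?S = "{z. cmod (a*z+b) \<le> cmod (c*z+d)}"
  have "closed ?S"
    by (intro closed_Collect_le continuous_intros)
  moreover have "ball 0 1 \<subseteq> ?S"
    using in_ball by (fastforce simp: norm_divide divide_less_eq_1)
  ultimately have "closure (ball 0 1) \<subseteq> ?S" by (rule closure_minimal[rotated])
  then have le: "cmod (a*z+b) \<le> cmod (c*z+d)" if "z \<in> cball 0 1" for z
    using that by auto
  have nz: "c*z+d \<noteq> 0" if "z \<in> cball 0 1" for z
  proof
    assume 0: "c*z+d = 0"
    then have "a*z+b = 0" using le[OF that] by simp
    then have "d = -c*z" "b = -a*z" using 0 by (simp_all add: eq_neg_iff_add_eq_0 add.commute)
    then show False using det by simp
  qed
  show "pole_free m" using det nz by (simp add: pole_free_def m moeb_det_def moeb_den_def)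
  show "moeb_app m z \<in> cball 0 1" if "z \<in> cball 0 1" for z
    using le[OF that] nz[OF that] by (simp add: m moeb_app_def norm_divide divide_le_eq_1)
qed

section \<open>Composition sequences on the closed disc\<close>

lemma compseq_add:
  "compseq act f (N + k) = compseq act f N \<circ> compseq act (\<lambda>i. f (N + i)) k"
  by (induction k) (simp_all add: comp_assoc)

lemma compseq_maps:
  assumes "\<And>n. n \<ge> 1 \<Longrightarrow> f n \<in> MD" "z \<in> cball 0 1"
  shows "compseq moeb_app f n z \<in> cball 0 1"
  using assms(2)
  proof (induction n arbitrary: z)
  case (Suc n)
  then show ?case using MD_pole_free_and_maps(2)[OF assms(1)[of "Suc n"]] by (simp del: mem_cball)
qed simp

text \<open>Lets facts about one coefficient quadruple be applied to a whole composite. The witness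
  is asserted to be \<open>pole_free\<close> rather than in \<open>MD\<close>, since for
  \<open>n = 0\<close> it is the identity.\<close>

lemma compseq_pole_free:
  assumes "\<And>n. n \<ge> 1 \<Longrightarrow> f n \<in> MD"
  shows "\<exists>m. pole_free m \<and> (\<forall>z\<in>cball 0 1. compseq moeb_app f n z = moeb_app m z)"
proof (induction n)
  case 0
  have "pole_free (1,0,0,1)" by (simp add: pole_free_def moeb_det_def moeb_den_def)
  then show ?case by (intro exI[of _ "(1,0,0,1)"]) (simp add: moeb_app_def)
next
  case (Suc n)
  then obtain m where m: "pole_free m" "\<And>z. z\<in>cball 0 1 \<Longrightarrow> compseq moeb_app f n z = moeb_app m z"
    by blast
  let ?g = "f (Suc n)"
  have g: "pole_free ?g" "\<And>z. z \<in> cball 0 1 \<Longrightarrow> moeb_app ?g z \<in> cball 0 1"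
    using MD_pole_free_and_maps[of ?g] assms[of "Suc n"] by auto
  have "pole_free (moeb_mul m ?g)"
    using m(1) g unfolding pole_free_def by (auto simp: moeb_det_mul moeb_den_mul simp del: mem_cball)
  moreover have "compseq moeb_app f (Suc n) z = moeb_app (moeb_mul m ?g) z" if "z \<in> cball 0 1" for z
    using that m g unfolding pole_free_def by (simp add: moeb_app_mul del: mem_cball)
  ultimately show ?case by blast
qed

lemma compseq_continuous_on:
  assumes "\<And>n. n \<ge> 1 \<Longrightarrow> f n \<in> MD"
  shows "continuous_on (cball 0 1) (compseq moeb_app f n)"
proof -
  obtain m where "pole_free m" "\<forall>z\<in>cball 0 1. compseq moeb_app f n z = moeb_app m z"
    using compseq_pole_free[of f n] assms by blast
  then show ?thesis
    using pole_free_continuous_on[of m] continuous_on_cong[of "cball 0 1" "cball 0 1"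
        "compseq moeb_app f n" "moeb_app m"] by blast
qed

lemma compseq_inj_on:
  assumes "\<And>n. n \<ge> 1 \<Longrightarrow> f n \<in> MD"
  shows "inj_on (compseq moeb_app f n) (cball 0 1)"
proof -
  obtain m where "pole_free m" "\<forall>z\<in>cball 0 1. compseq moeb_app f n z = moeb_app m z"
    using compseq_pole_free[of f n] assms by blast
  then show ?thesis
    using pole_free_inj_on[of m] inj_on_cong[of "cball 0 1" "compseq moeb_app f n" "moeb_app m"]
    by blast
qed

lemma compseq_image_antimono:
  assumes "\<And>n. n \<ge> 1 \<Longrightarrow> f n \<in> MD" "n \<le> k"
  shows "compseq moeb_app f k ` cball 0 1 \<subseteq> compseq moeb_app f n ` cball 0 1"
proof -
  obtain j where k: "k = n + j" using assms(2) le_Suc_ex by blast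
  have "compseq moeb_app (\<lambda>i. f (n + i)) j ` cball 0 1 \<subseteq> cball 0 1"
    using compseq_maps[of "\<lambda>i. f (n + i)"] assms(1) by (auto simp del: mem_cball)
  then show ?thesis unfolding k compseq_add image_comp[symmetric] by blast
qed

section \<open>Cayley transforms and tangent maps as affine maps of the right half-plane\<close>

definition cayley :: "complex \<Rightarrow> complex \<Rightarrow> complex" where
  "cayley \<alpha> z = (\<alpha> + z) / (\<alpha> - z)"

definition cayley_inv :: "complex \<Rightarrow> complex \<Rightarrow> complex" where
  "cayley_inv \<alpha> w = \<alpha> * (w - 1) / (w + 1)"

lemma Re_cayley:
  assumes "cmod \<alpha> = 1"
  shows "Re (cayley \<alpha> z) = (1 - (cmod z)\<^sup>2) / (cmod (\<alpha> - z))\<^sup>2"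
proof -
  have "cayley \<alpha> z = (\<alpha> + z) * cnj (\<alpha> - z) / of_real ((cmod (\<alpha> - z))\<^sup>2)"
    unfolding cayley_def by (subst complex_div_cnj) (simp add: power2_eq_square)
  then have "Re (cayley \<alpha> z) = Re ((\<alpha> + z) * cnj (\<alpha> - z)) / (cmod (\<alpha> - z))\<^sup>2"
    by (simp only: Re_divide_of_real)
  also have "Re ((\<alpha> + z) * cnj (\<alpha> - z)) = (cmod \<alpha>)\<^sup>2 - (cmod z)\<^sup>2"
    unfolding cmod_power2 by (simp add: algebra_simps power2_eq_square)
  finally show ?thesis using assms by simp
qed

text \<open>The point \<alpha> corresponds to infinity, but \<open>cayley \<alpha> \<alpha>\<close>
  is 0 by division by zero. This is why \<alpha> is excluded here and in all later statements about
  \<open>cayley\<close>.\<close>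

lemma cayley_inv_cayley:
  assumes "\<alpha> \<noteq> 0" "z \<noteq> \<alpha>"
  shows "cayley_inv \<alpha> (cayley \<alpha> z) = z"
proof -
  have "\<alpha> - z \<noteq> 0" using assms by simp
  then have 1: "cayley \<alpha> z - 1 = 2 * z / (\<alpha> - z)" and 2: "cayley \<alpha> z + 1 = 2 * \<alpha> / (\<alpha> - z)"
    unfolding cayley_def by (simp_all add: field_simps)
  show ?thesis unfolding cayley_inv_def 1 2 using assms by simp
qed

lemma cayley_cayley_inv:
  assumes "\<alpha> \<noteq> 0" "Re w > 0"
  shows "cayley \<alpha> (cayley_inv \<alpha> w) = w"
proof -
  have w: "w + 1 \<noteq> 0" using assms(2) by (auto simp: complex_eq_iff)
  have 1: "\<alpha> + cayley_inv \<alpha> w = 2 * \<alpha> * w / (w + 1)"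
   and 2: "\<alpha> - cayley_inv \<alpha> w = 2 * \<alpha> / (w + 1)"
    using w unfolding cayley_inv_def by (simp_all add: field_simps)
  show ?thesis unfolding cayley_def 1 2 using w assms(1) by simp
qed

lemma cayley_inv_in_ball:
  assumes "cmod \<alpha> = 1" "Re w > 0"
  shows "cayley_inv \<alpha> w \<in> ball 0 1"
proof -
  have w: "w + 1 \<noteq> 0" using assms(2) by (auto simp: complex_eq_iff)
  have "(cmod (w - 1))\<^sup>2 < (cmod (w + 1))\<^sup>2"
    using assms(2) unfolding cmod_power2 by (simp add: power2_eq_square algebra_simps)
  then have "cmod (w - 1) < cmod (w + 1)" by (rule power2_less_imp_less) simp
  then show ?thesis using assms(1) w
    by (simp add: cayley_inv_def norm_mult norm_divide)
qed

text \<open>The Cayley transforms at \<alpha> and at its image turn the map into one that fixes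
  infinity, hence into an affine one.\<close>

lemma cayley_affine:
  assumes "moeb_det m \<noteq> 0" "moeb_den m \<alpha> \<noteq> 0" "\<alpha> \<noteq> 0" "moeb_app m \<alpha> \<noteq> 0"
  obtains \<sigma> \<tau> where "\<sigma> \<noteq> 0"
    "\<And>z. moeb_den m z \<noteq> 0 \<Longrightarrow> z \<noteq> \<alpha> \<Longrightarrow>
       cayley (moeb_app m \<alpha>) (moeb_app m z) = \<sigma> * cayley \<alpha> z + \<tau>"
proof -
  define \<beta> where "\<beta> = moeb_app m \<alpha>"
  obtain a b c d where m: "m = (a,b,c,d)" by (metis prod_cases4)
  define D where "D = moeb_det m"
  define E where "E = moeb_den m \<alpha>"
  \<comment> \<open>Both constants come from
    \<open>cayley \<beta> w = 2 * \<beta> / (\<beta> - w) - 1\<close>, with the denominator of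
    \<open>m\<close> expanded at \<alpha> as \<open>E - c * (\<alpha> - z)\<close>: the term
    \<open>E\<close> gives the slope, the term with \<open>c\<close> a constant.\<close>
  define \<sigma> where "\<sigma> = \<beta> * E\<^sup>2 / (\<alpha> * D)"
  define \<tau> where "\<tau> = \<sigma> - 2 * \<beta> * c * E / D - 1"
  have nz: "D \<noteq> 0" "E \<noteq> 0" "\<beta> \<noteq> 0" using assms by (auto simp: D_def E_def \<beta>_def)
  show thesis
  proof (rule that[of \<sigma> \<tau>])
    show "\<sigma> \<noteq> 0" using nz assms by (simp add: \<sigma>_def)
    fix z assume z: "moeb_den m z \<noteq> 0" "z \<noteq> \<alpha>"
    have az: "\<alpha> - z \<noteq> 0" using z by simp
    have den: "moeb_den m z = E - c * (\<alpha> - z)"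
      by (simp add: m E_def moeb_den_def algebra_simps)
    have diff: "\<beta> - moeb_app m z = D * (\<alpha> - z) / (E * moeb_den m z)"
      unfolding \<beta>_def D_def E_def by (rule moeb_app_diff) (use assms z in auto)
    have nzd: "\<beta> - moeb_app m z \<noteq> 0" unfolding diff using nz az z by simp
    have "cayley \<beta> (moeb_app m z) = 2 * \<beta> / (\<beta> - moeb_app m z) - 1"
      using nzd unfolding cayley_def by (simp add: field_simps)
    also have "\<dots> = 2 * \<beta> * E * (E - c * (\<alpha> - z)) / (D * (\<alpha> - z)) - 1"
      unfolding diff den using nz by simp
    also have "\<dots> = \<sigma> * (2 * \<alpha> / (\<alpha> - z)) - 2 * \<beta> * c * E / D - 1"
    proof -
      have "2 * \<beta> * E * (c * (\<alpha> - z)) / (D * (\<alpha> - z)) = 2 * \<beta> * c * E / D"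
        using az by simp
      moreover have "2 * \<beta> * E * E / (D * (\<alpha> - z)) = \<sigma> * (2 * \<alpha> / (\<alpha> - z))"
        unfolding \<sigma>_def using assms(3) by (simp add: power2_eq_square)
      ultimately show ?thesis by (simp only: right_diff_distrib diff_divide_distrib)
    qed
    also have "2 * \<alpha> / (\<alpha> - z) = cayley \<alpha> z + 1"
      unfolding cayley_def using az by (simp add: field_simps)
    finally show "cayley (moeb_app m \<alpha>) (moeb_app m z) = \<sigma> * cayley \<alpha> z + \<tau>"
      unfolding \<beta>_def[symmetric] \<tau>_def by (simp add: algebra_simps)
  qed
qed

text \<open>A nonreal slope would turn the half-plane: the height chosen over real part 1 makes the
  real part of the image exactly 0. Positive real test points then settle the signs, a suitable one
  for each of \<open>Re \<tau>\<close> and \<open>Re \<sigma>\<close>.\<close>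

lemma half_plane_affine:
  fixes \<sigma> \<tau> :: complex
  assumes "\<sigma> \<noteq> 0" "\<And>w. Re w > 0 \<Longrightarrow> Re (\<sigma> * w + \<tau>) > 0"
  shows "\<sigma> = of_real (Re \<sigma>)" "Re \<sigma> > 0" "Re \<tau> \<ge> 0"
proof -
  have im: "Im \<sigma> = 0"
  proof (rule ccontr)
    assume "Im \<sigma> \<noteq> 0"
    then have "Im \<sigma> * ((Re \<sigma> + Re \<tau>) / Im \<sigma>) = Re \<sigma> + Re \<tau>" by simp
    then show False using assms(2)[of "Complex 1 ((Re \<sigma> + Re \<tau>) / Im \<sigma>)"] by simp
  qed
  then show eq: "\<sigma> = of_real (Re \<sigma>)" by (simp add: complex_eq_iff)
  have pos: "Re \<sigma> * r + Re \<tau> > 0" if "r > 0" for r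
    using assms(2)[of "of_real r"] that im by simp
  have ne: "Re \<sigma> \<noteq> 0" using eq assms(1) by auto
  show "Re \<tau> \<ge> 0"
  proof (rule ccontr)
    assume n: "\<not> Re \<tau> \<ge> 0"
    define r where "r = - Re \<tau> / \<bar>Re \<sigma>\<bar>"
    have "r > 0" unfolding r_def using n ne by (intro divide_pos_pos) auto
    moreover have "\<bar>Re \<sigma>\<bar> * r = - Re \<tau>" using ne by (simp add: r_def)
    moreover have "Re \<sigma> * r \<le> \<bar>Re \<sigma>\<bar> * r" using \<open>r > 0\<close> by (intro mult_right_mono) auto
    ultimately show False using pos[of r] by linarith
  qed
  show "Re \<sigma> > 0"
  proof (rule ccontr)
    assume "\<not> Re \<sigma> > 0"
    then have n: "Re \<sigma> < 0" using ne by simp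
    then have "Re \<sigma> * ((\<bar>Re \<tau>\<bar> + 1) / (- Re \<sigma>)) = - (\<bar>Re \<tau>\<bar> + 1)" by (simp add: field_simps)
    moreover have "(\<bar>Re \<tau>\<bar> + 1) / (- Re \<sigma>) > 0" using n by (intro divide_pos_pos) auto
    ultimately show False using pos[of "(\<bar>Re \<tau>\<bar> + 1) / (- Re \<sigma>)"] by linarith
  qed
qed

text \<open>Strictness of \<open>Re \<tau> > 0\<close> is where the image being a proper part of the
  disc enters: with \<open>Re \<tau> = 0\<close> the affine map could be solved for every point of
  the half-plane, so the image would be the whole disc.\<close>

lemma MD_cayley_affine:
  assumes "m \<in> MD" "cmod \<alpha> = 1" "cmod (moeb_app m \<alpha>) = 1"
  obtains s :: real and \<tau> where "s > 0" "Re \<tau> > 0"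
    "\<And>z. z \<in> cball 0 1 \<Longrightarrow> z \<noteq> \<alpha> \<Longrightarrow>
       cayley (moeb_app m \<alpha>) (moeb_app m z) = of_real s * cayley \<alpha> z + \<tau>"
proof -
  note reg = MD_pole_free_and_maps(1)[OF assms(1)]
  have nz: "\<alpha> \<noteq> 0" "moeb_app m \<alpha> \<noteq> 0" using assms by auto
  obtain \<sigma> \<tau> where st: "\<sigma> \<noteq> 0"
    "\<And>z. moeb_den m z \<noteq> 0 \<Longrightarrow> z \<noteq> \<alpha> \<Longrightarrow>
       cayley (moeb_app m \<alpha>) (moeb_app m z) = \<sigma> * cayley \<alpha> z + \<tau>"
  proof (rule cayley_affine)
    show "moeb_det m \<noteq> 0" "moeb_den m \<alpha> \<noteq> 0"
      using reg assms(2) unfolding pole_free_def by auto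
  qed (use nz in auto)
  have aff: "cayley (moeb_app m \<alpha>) (moeb_app m z) = \<sigma> * cayley \<alpha> z + \<tau>"
    if "z \<in> cball 0 1" "z \<noteq> \<alpha>" for z
    using st(2) that reg by (auto simp: pole_free_def)
  have inner: "cayley_inv \<alpha> w \<in> cball 0 1" "cayley_inv \<alpha> w \<noteq> \<alpha>" 
    "cayley \<alpha> (cayley_inv \<alpha> w) = w" "cayley_inv \<alpha> w \<in> ball 0 1" if "Re w > 0" for w
    using cayley_inv_in_ball[OF assms(2) that] cayley_cayley_inv[OF nz(1) that] assms(2) by auto
  have pos: "Re (\<sigma> * w + \<tau>) > 0" if "Re w > 0" for w
  proof -
    let ?z = "moeb_app m (cayley_inv \<alpha> w)"
    have "?z \<in> ball 0 1" using assms(1) inner(4)[OF that] unfolding MD_def by blast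
    then have "cmod ?z < 1" by simp
    then have "(cmod ?z)\<^sup>2 < 1" "?z \<noteq> moeb_app m \<alpha>"
      using assms(3) by (auto simp: abs_square_less_1)
    then have "Re (cayley (moeb_app m \<alpha>) ?z) > 0"
      unfolding Re_cayley[OF assms(3)] by (intro divide_pos_pos) auto
    then show ?thesis using aff inner[OF that] by simp
  qed
  note h = half_plane_affine[OF st(1) pos]
  define s where "s = Re \<sigma>"
  have s1: "\<sigma> = of_real s" unfolding s_def by (rule h(1))
  have s2: "s > 0" unfolding s_def by (rule h(2))
  have "Re \<tau> \<noteq> 0"
  proof
    assume 0: "Re \<tau> = 0"
    have "ball 0 1 \<subseteq> moeb_app m ` ball 0 1"
    proof
      fix u :: complex assume u: "u \<in> ball 0 1"
      let ?v = "cayley (moeb_app m \<alpha>) u"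
      have "cmod u < 1" using u by simp
      then have u1: "(cmod u)\<^sup>2 < 1" "u \<noteq> moeb_app m \<alpha>"
        using assms(3) by (auto simp: abs_square_less_1)
      then have v: "Re ?v > 0"
        unfolding Re_cayley[OF assms(3)] by (intro divide_pos_pos) auto
      define w where "w = (?v - \<tau>) / \<sigma>"
      have "Re w = Re ?v / s"
        unfolding w_def s1 by (simp only: Re_divide_of_real) (simp add: 0)
      then have w: "Re w > 0" using v s2 by simp
      let ?z = "cayley_inv \<alpha> w"
      have "cayley (moeb_app m \<alpha>) (moeb_app m ?z) = \<sigma> * w + \<tau>"
        using aff inner[OF w] by simp
      also have "\<dots> = ?v" using st(1) by (simp add: w_def)
      finally have eq: "cayley (moeb_app m \<alpha>) (moeb_app m ?z) = ?v" .
      have "moeb_app m ?z \<in> ball 0 1" using assms(1) inner(4)[OF w] unfolding MD_def by blast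
      then have "moeb_app m ?z \<noteq> moeb_app m \<alpha>" using assms(3) by auto
      then have "moeb_app m ?z = cayley_inv (moeb_app m \<alpha>) (cayley (moeb_app m \<alpha>) (moeb_app m ?z))"
        by (rule cayley_inv_cayley[OF nz(2), symmetric])
      also have "\<dots> = u" unfolding eq by (rule cayley_inv_cayley[OF nz(2) u1(2)])
      finally have "moeb_app m ?z = u" .
      then show "u \<in> moeb_app m ` ball 0 1" using inner(4)[OF w] by blast
    qed
    then show False using assms(1) unfolding MD_def by blast
  qed
  then have t: "Re \<tau> > 0" using h(3) by simp
  show thesis
  proof (rule that[OF s2 t])
    fix z assume "z \<in> cball 0 1" "z \<noteq> \<alpha>"
    then show "cayley (moeb_app m \<alpha>) (moeb_app m z) = of_real s * cayley \<alpha> z + \<tau>"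
      unfolding s1[symmetric] by (rule aff)
  qed
qed

text \<open>In half-plane coordinates the closed half-plane is scaled and then shifted by a vector
  with positive real part, so it lands in the open one.\<close>

lemma MD_tangent_unique:
  assumes "m \<in> MD" "cmod \<alpha> = 1" "cmod (moeb_app m \<alpha>) = 1" "z \<in> cball 0 1" "z \<noteq> \<alpha>"
  shows "cmod (moeb_app m z) < 1"
proof -
  obtain s :: real and \<tau> where st: "s > 0" "Re \<tau> > 0"
    "cayley (moeb_app m \<alpha>) (moeb_app m z) = of_real s * cayley \<alpha> z + \<tau>"
    using MD_cayley_affine[OF assms(1-3)] assms(4,5) by metis
  have "(cmod z)\<^sup>2 \<le> 1" using assms(4) by (simp add: abs_square_le_1)
  then have "Re (cayley \<alpha> z) \<ge> 0" unfolding Re_cayley[OF assms(2)] by simp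
  then have "Re (cayley (moeb_app m \<alpha>) (moeb_app m z)) > 0"
    unfolding st(3) using st(1,2) by (simp add: add_nonneg_pos)
  then have "(cmod (moeb_app m z))\<^sup>2 < 1"
    unfolding Re_cayley[OF assms(3)] by (simp add: zero_less_divide_iff)
  then show ?thesis by (simp add: abs_square_less_1)
qed

lemma alpha_eq:
  assumes "m \<in> MD" "cmod w = 1" "cmod (moeb_app m w) = 1"
  shows "alpha m = w"
proof -
  let ?P = "\<lambda>w. w \<in> sphere 0 1 \<and> moeb_app m w \<in> sphere 0 1"
  have w: "?P w" using assms by simp
  have u: "v = w" if "?P v" for v
    using MD_tangent_unique[OF assms, of v] that by fastforce
  have "\<exists>!w. ?P w" using w u by blast
  moreover have "(THE w. ?P w) = w" using w u by (rule the_equality)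
  ultimately show ?thesis unfolding alpha_def by simp
qed

section \<open>Shrinking of nested discs\<close>

lemma cmod_one_minus_cnj_mult:
  "(cmod (1 - cnj x * y))\<^sup>2 - (cmod (x - y))\<^sup>2 = (1 - (cmod x)\<^sup>2) * (1 - (cmod y)\<^sup>2)"
  unfolding cmod_power2 by (simp add: algebra_simps power2_eq_square)

lemma cmod_diff_le_one_minus:
  assumes "cmod x \<le> 1" "cmod y \<le> 1"
  shows "cmod (x - y) \<le> cmod (1 - cnj x * y)"
proof -
  have "(1 - (cmod x)\<^sup>2) * (1 - (cmod y)\<^sup>2) \<ge> 0"
    using assms by (simp add: abs_square_le_1)
  then have "(cmod (x - y))\<^sup>2 \<le> (cmod (1 - cnj x * y))\<^sup>2"
    using cmod_one_minus_cnj_mult[of x y] by linarith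
  then show ?thesis by (rule power2_le_imp_le) simp
qed

text \<open>An upper bound for the pseudohyperbolic distance
  \<open>cmod (z - w) / cmod (1 - cnj z * w)\<close> on the disc of radius \<open>s\<close>. The
  squares of denominator and numerator differ by
  \<open>(1 - (cmod z)\<^sup>2) * (1 - (cmod w)\<^sup>2)\<close>, which is at least
  \<open>(1 - s\<^sup>2)\<^sup>2\<close>; the 4 comes from the denominator being at most 2.\<close>

definition shrink_factor :: "real \<Rightarrow> real" where
  "shrink_factor s = sqrt (1 - (1 - s\<^sup>2)\<^sup>2 / 4)"

lemma shrink_factor_bounds:
  assumes "0 \<le> s" "s < 1"
  shows "0 \<le> shrink_factor s" "shrink_factor s < 1" "(shrink_factor s)\<^sup>2 = 1 - (1 - s\<^sup>2)\<^sup>2 / 4"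
proof -
  have "s\<^sup>2 < 1" "0 \<le> s\<^sup>2" using assms by (auto simp: abs_square_less_1)
  then have "0 < (1 - s\<^sup>2)\<^sup>2" "(1 - s\<^sup>2)\<^sup>2 \<le> 1" by (simp, intro power_le_one) simp_all
  then have "0 \<le> 1 - (1 - s\<^sup>2)\<^sup>2 / 4" "1 - (1 - s\<^sup>2)\<^sup>2 / 4 < 1" by linarith+
  then show "0 \<le> shrink_factor s" "shrink_factor s < 1" "(shrink_factor s)\<^sup>2 = 1 - (1 - s\<^sup>2)\<^sup>2 / 4"
    unfolding shrink_factor_def by (simp only: real_sqrt_ge_0_iff, simp only: real_sqrt_lt_1_iff,
      simp only: real_sqrt_pow2)
qed

lemma pseudohyperbolic_bound:
  assumes "0 \<le> s" "s < 1" "cmod z \<le> s" "cmod w \<le> s"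
  shows "cmod (z - w) \<le> shrink_factor s * cmod (1 - cnj z * w)"
proof -
  let ?D = "cmod (1 - cnj z * w)"
  have s1: "1 - s\<^sup>2 \<ge> 0" using assms(1,2) by (simp add: abs_square_le_1)
  have zz: "(cmod z)\<^sup>2 \<le> s\<^sup>2" "(cmod w)\<^sup>2 \<le> s\<^sup>2"
    by (rule power_mono[OF assms(3) norm_ge_zero], rule power_mono[OF assms(4) norm_ge_zero])
  have "cmod z * cmod w \<le> 1 * 1" using assms by (intro mult_mono) simp_all
  then have "?D \<le> 2" using norm_triangle_ineq4[of 1 "cnj z * w"] by (simp add: norm_mult)
  then have "?D\<^sup>2 \<le> 2\<^sup>2" by (rule power_mono) simp
  then have "(1 - s\<^sup>2)\<^sup>2 / 4 * ?D\<^sup>2 \<le> (1 - s\<^sup>2)\<^sup>2 / 4 * 2\<^sup>2" by (rule mult_left_mono) simp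
  also have "\<dots> = (1 - s\<^sup>2) * (1 - s\<^sup>2)" by (simp add: power2_eq_square)
  also have "\<dots> \<le> (1 - (cmod z)\<^sup>2) * (1 - (cmod w)\<^sup>2)" using s1 zz by (intro mult_mono) linarith+
  also have "\<dots> = ?D\<^sup>2 - (cmod (z - w))\<^sup>2" by (rule cmod_one_minus_cnj_mult[symmetric])
  finally have "(cmod (z - w))\<^sup>2 \<le> (1 - (1 - s\<^sup>2)\<^sup>2 / 4) * ?D\<^sup>2"
    unfolding left_diff_distrib[of 1] by linarith
  also have "1 - (1 - s\<^sup>2)\<^sup>2 / 4 = (shrink_factor s)\<^sup>2"
    by (rule shrink_factor_bounds(3)[OF assms(1,2), symmetric])
  finally have "(cmod (z - w))\<^sup>2 \<le> (shrink_factor s * ?D)\<^sup>2" by (simp add: power_mult_distrib)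
  then show ?thesis
    by (rule power2_le_imp_le) (simp add: shrink_factor_bounds(1)[OF assms(1,2)])
qed

text \<open>The factor depends on \<open>s\<close> alone, not on \<open>m\<close>. Indeed
  \<open>m\<close> is a disc automorphism followed by a similarity; the automorphism preserves
  pseudohyperbolic distance, and the similarity cancels in a ratio of distances.\<close>

lemma pole_free_contraction:
  assumes "pole_free m"
  obtains u v where "u \<in> cball 0 1" "v \<in> cball 0 1"
    "\<And>s z w. 0 \<le> s \<Longrightarrow> s < 1 \<Longrightarrow> cmod z \<le> s \<Longrightarrow> cmod w \<le> s \<Longrightarrow>
       cmod (moeb_app m z - moeb_app m w) \<le> shrink_factor s * cmod (moeb_app m u - moeb_app m v)"
proof -
  obtain a b c d where m: "m = (a,b,c,d)" by (metis prod_cases4)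
  have den: "c * z + d \<noteq> 0" if "cmod z \<le> 1" for z
    using assms that by (auto simp: pole_free_def moeb_den_def m)
  have d: "d \<noteq> 0" using den[of 0] by simp
  \<comment> \<open>Chosen so that the denominator of \<open>m\<close> becomes
    \<open>d * (1 - cnj e * z)\<close>; the pole lying outside the closed disc is what makes
    \<open>cmod e < 1\<close>.\<close>
  define e where "e = - cnj (c / d)"
  have e1: "cmod e < 1"
  proof (rule ccontr)
    assume "\<not> cmod e < 1"
    then have "c \<noteq> 0" "cmod d \<le> cmod c" using d by (auto simp: e_def norm_divide)
    then show False using den[of "- d / c"] by (simp add: norm_divide)
  qed
  have "cmod (cnj e) < 1" using e1 by simp
  then have ece: "cnj e \<noteq> 1" "cnj e \<noteq> -1" by (metis less_irrefl norm_one, metis less_irrefl norm_minus_cancel norm_one)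
  define q where "q = (cmod e)\<^sup>2"
  have q: "q < 1" "0 \<le> q" using e1 by (auto simp: q_def abs_square_less_1)
  have eq: "cnj e * e = of_real q" "e * cnj e = of_real q"
    by (simp_all add: q_def complex_norm_square mult.commute del: of_real_power)
  have dene: "moeb_den m z = d * (1 - cnj e * z)" for z
    using d by (simp add: m moeb_den_def e_def algebra_simps)
  define K where "K = moeb_det m / d\<^sup>2"
  have nz: "1 - cnj e * z \<noteq> 0" if "cmod z \<le> 1" for z
    using assms dene[of z] that by (auto simp: pole_free_def)
  have diff: "moeb_app m z - moeb_app m w = K * ((z - w) / ((1 - cnj e * z) * (1 - cnj e * w)))"
    if "cmod z \<le> 1" "cmod w \<le> 1" for z w
  proof -
    have "moeb_app m z - moeb_app m w = moeb_det m * (z - w) / (moeb_den m z * moeb_den m w)"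
      by (rule moeb_app_diff) (use assms that in \<open>auto simp: pole_free_def\<close>)
    then show ?thesis unfolding dene K_def by (simp add: power2_eq_square)
  qed
  \<comment> \<open>The preimages of \<open>1\<close> and \<open>-1\<close> under the disc automorphism
    \<open>z \<mapsto> (z - e) / (1 - cnj e * z)\<close>, which has the same pole as \<open>m\<close>.\<close>
  define u where "u = (1 + e) / (1 + cnj e)"
  define v where "v = (e - 1) / (1 - cnj e)"
  have n1: "1 + cnj e \<noteq> 0" "1 - cnj e \<noteq> 0"
    using ece by (auto simp: add_eq_0_iff)
  have "cmod (1 + e) = cmod (1 + cnj e)" "cmod (e - 1) = cmod (1 - cnj e)"
    using complex_mod_cnj[of "1 + e"] complex_mod_cnj[of "1 - e"] by (auto simp: norm_minus_commute)
  then have uv1: "cmod u = 1" "cmod v = 1"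
    using n1 unfolding u_def v_def norm_divide by auto
  have "1 - cnj e * u = of_real (1 - q) / (1 + cnj e)"
    using n1(1) eq unfolding u_def by (simp add: field_simps)
  moreover have "1 - cnj e * v = of_real (1 - q) / (1 - cnj e)"
    using n1(2) eq unfolding v_def by (simp add: field_simps)
  moreover have "u - v = 2 * of_real (1 - q) / ((1 + cnj e) * (1 - cnj e))"
    using n1 eq unfolding u_def v_def by (simp add: diff_frac_eq) (simp add: algebra_simps)
  moreover have "(2 * r / (x * y)) / ((r / x) * (r / y)) = 2 / r"
    if "r \<noteq> 0" "x \<noteq> 0" "y \<noteq> 0" for r x y :: complex
    using that by (simp add: field_simps)
  moreover have "complex_of_real (1 - q) \<noteq> 0" using q by (simp del: of_real_diff)
  ultimately have "(u - v) / ((1 - cnj e * u) * (1 - cnj e * v)) = 2 / of_real (1 - q)"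
    using n1 by presburger
  \<comment> \<open>This is the diameter of the image disc: the automorphism sends \<open>u\<close>
    and \<open>v\<close> to 1 and -1, and the similarity scales by
    \<open>cmod K / (1 - q)\<close>.\<close>
  then have uv: "cmod (moeb_app m u - moeb_app m v) = cmod K * (2 / (1 - q))"
    using diff[of u v] uv1 q by (simp add: norm_mult norm_divide del: of_real_diff)
  show thesis
  proof (rule that[of u v])
    fix s z w assume s: "0 \<le> s" "s < 1" "cmod z \<le> s" "cmod w \<le> s"
    then have zw: "cmod z \<le> 1" "cmod w \<le> 1" by auto
    \<comment> \<open>The invariance of \<open>1 - cnj z * w\<close> under the automorphism, with
      denominators cleared. Since the images of \<open>z\<close> and \<open>w\<close> have modulus
      at most 1, the right side is at most twice \<open>?P\<close>.\<close>
    have id: "of_real (1 - q) * (1 - cnj z * w) =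
        cnj (1 - cnj e * z) * (1 - cnj e * w) - cnj (z - e) * (w - e)"
      using eq by (simp add: algebra_simps)
    have ze: "cmod (z - e) \<le> cmod (1 - cnj e * z)" "cmod (w - e) \<le> cmod (1 - cnj e * w)"
      using cmod_diff_le_one_minus[of e z] cmod_diff_le_one_minus[of e w] zw e1
      by (auto simp: norm_minus_commute)
    let ?P = "cmod (1 - cnj e * z) * cmod (1 - cnj e * w)"
    have P: "?P > 0" using nz zw by simp
    have "(1 - q) * cmod (1 - cnj z * w) = cmod (of_real (1 - q) * (1 - cnj z * w))"
      using q by (simp add: norm_mult del: of_real_diff)
    also have "\<dots> \<le> ?P + cmod (z - e) * cmod (w - e)"
      unfolding id using norm_triangle_ineq4 by (metis complex_mod_cnj norm_mult)
    also have "\<dots> \<le> 2 * ?P" using mult_mono[OF ze norm_ge_zero norm_ge_zero] by linarith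
    finally have 1: "(1 - q) * cmod (1 - cnj z * w) \<le> 2 * ?P" .
    have "(1 - q) * cmod (z - w) \<le> (1 - q) * (shrink_factor s * cmod (1 - cnj z * w))"
      using pseudohyperbolic_bound[OF s] q by (intro mult_left_mono) auto
    also have "\<dots> \<le> shrink_factor s * (2 * ?P)"
      using mult_left_mono[OF 1 shrink_factor_bounds(1)[OF s(1,2)]] by (simp add: mult_ac)
    finally have "cmod (z - w) / ?P \<le> shrink_factor s * (2 / (1 - q))"
      using P q by (simp add: field_simps)
    then have "cmod K * (cmod (z - w) / ?P) \<le> cmod K * (shrink_factor s * (2 / (1 - q)))"
      by (rule mult_left_mono) simp
    then show "cmod (moeb_app m z - moeb_app m w) \<le> shrink_factor s * cmod (moeb_app m u - moeb_app m v)"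
      unfolding uv diff[OF zw] by (simp add: norm_mult norm_divide mult_ac)
  qed (use uv1 in auto)
qed

section \<open>Nested compact discs and the limit-point type\<close>

lemma compact_nest_singleton:
  fixes K :: "nat \<Rightarrow> 'a::heine_borel set"
  assumes "\<And>n. compact (K n)" "\<And>n k. n \<le> k \<Longrightarrow> K k \<subseteq> K n" "(\<Inter>n. K n) = {p}" "e > 0"
  obtains N where "K N \<subseteq> ball p e"
proof (rule ccontr)
  assume "\<not> thesis"
  \<comment> \<open>Removing the ball leaves nested nonempty compact sets, whose common point would
    be a point of the intersection other than \<open>p\<close>.\<close>
  then have "K n - ball p e \<noteq> {}" for n using that by blast
  moreover have "compact (K n - ball p e)" for n using assms(1) by (simp add: compact_diff)
  moreover have "K k - ball p e \<subseteq> K n - ball p e" if "n \<le> k" for n k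
    using assms(2)[OF that] by blast
  ultimately have "(\<Inter>n. K n - ball p e) \<noteq> {}" by (intro compact_nest)
  moreover have "(\<Inter>n. K n - ball p e) \<subseteq> (\<Inter>n. K n) - ball p e" by blast
  ultimately show False using assms(3,4) by auto
qed

lemma compseq_compact:
  assumes "\<And>n. n \<ge> 1 \<Longrightarrow> f n \<in> MD"
  shows "compact (compseq moeb_app f n ` cball 0 1)"
  by (intro compact_continuous_image compseq_continuous_on assms compact_cball)

lemma limit_point_type_uniform:
  assumes "\<And>n. n \<ge> 1 \<Longrightarrow> f n \<in> MD" "(\<Inter>n. compseq moeb_app f n ` cball 0 1) = {p}" "e > 0"
  obtains N where "\<And>n z. n \<ge> N \<Longrightarrow> z \<in> cball 0 1 \<Longrightarrow> dist (compseq moeb_app f n z) p < e"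
proof -
  obtain N where N: "compseq moeb_app f N ` cball 0 1 \<subseteq> ball p e"
    by (rule compact_nest_singleton[of "\<lambda>n. compseq moeb_app f n ` cball 0 1" p e])
      (use assms compseq_compact[of f] compseq_image_antimono[of f] in auto)
  show thesis
  proof (rule that)
    fix n and z :: complex assume "n \<ge> N" "z \<in> cball 0 1"
    then have "compseq moeb_app f n z \<in> ball p e"
      using N compseq_image_antimono[of f N n] assms(1) by blast
    then show "dist (compseq moeb_app f n z) p < e" by (simp add: dist_commute)
  qed
qed

lemma limit_point_typeI:
  assumes "\<And>n. n \<ge> 1 \<Longrightarrow> f n \<in> MD"
    and "\<And>e. e > 0 \<Longrightarrow> \<exists>n. \<forall>z\<in>cball 0 1. \<forall>w\<in>cball 0 1.
           dist (compseq moeb_app f n z) (compseq moeb_app f n w) < e"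
  shows "limit_point_type (compseq moeb_app f)"
proof -
  let ?K = "\<lambda>n. compseq moeb_app f n ` cball 0 1"
  have "(\<Inter>n. ?K n) \<noteq> {}"
    by (rule compact_nest) (use assms(1) compseq_compact[of f] compseq_image_antimono[of f] in auto)
  then obtain p where p: "p \<in> (\<Inter>n. ?K n)" by blast
  have "x = p" if "x \<in> (\<Inter>n. ?K n)" for x
  proof (rule ccontr)
    assume "x \<noteq> p"
    then obtain n where n: "\<forall>z\<in>cball 0 1. \<forall>w\<in>cball 0 1.
           dist (compseq moeb_app f n z) (compseq moeb_app f n w) < dist x p"
      using assms(2)[of "dist x p"] by auto
    have "x \<in> ?K n" "p \<in> ?K n" using p that by blast+
    then obtain z w where "z \<in> cball 0 1" "w \<in> cball 0 1"
      "x = compseq moeb_app f n z" "p = compseq moeb_app f n w" by blast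
    then show False using n by blast
  qed
  then have "(\<Inter>n. ?K n) = {p}" using p by blast
  then show ?thesis unfolding limit_point_type_def by blast
qed

text \<open>\<open>compseq moeb_app f n\<close> carries no distortion bound of its own, but a block
  landing in \<open>cball 0 s\<close> multiplies the diameter of the image disc by at most
  \<open>shrink_factor s\<close>, whatever precedes it.\<close>

lemma limit_point_type_if_contracting_blocks:
  assumes MD: "\<And>n. n \<ge> 1 \<Longrightarrow> f n \<in> MD"
    and s: "0 \<le> s" "s < 1"
    and inf: "infinite {n. compseq moeb_app (\<lambda>i. f (n + i)) k ` cball 0 1 \<subseteq> cball 0 s}"
  shows "limit_point_type (compseq moeb_app f)"
proof -
  let ?K = "\<lambda>n. compseq moeb_app f n ` cball 0 1"
  define d where "d n = diameter (?K n)" for n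
  have bdd: "bounded (?K n)" for n using compseq_compact[of f] MD compact_imp_bounded by blast
  have dec: "d k \<le> d n" if "n \<le> k" for n k
    unfolding d_def by (intro diameter_subset compseq_image_antimono MD that bdd)
  have d0: "d n \<ge> 0" for n unfolding d_def using bdd by (rule diameter_ge_0)
  have "decseq d" using dec by (simp add: decseq_def)
  then obtain L where L: "d \<longlonglongrightarrow> L" "\<And>n. L \<le> d n"
    using decseq_convergent[of d 0] d0 by blast
  have L0: "L \<ge> 0" using LIMSEQ_le_const[OF L(1)] d0 by blast
  have contract: "d (n + k) \<le> shrink_factor s * d n"
    if n: "compseq moeb_app (\<lambda>i. f (n + i)) k ` cball 0 1 \<subseteq> cball 0 s" for n
  proof -
    obtain m where m: "pole_free m" "\<And>z. z\<in>cball 0 1 \<Longrightarrow> compseq moeb_app f n z = moeb_app m z"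
      using compseq_pole_free[of f n] MD by blast
    obtain u v where uv: "u \<in> cball 0 1" "v \<in> cball 0 1"
      "\<And>s z w. 0 \<le> s \<Longrightarrow> s < 1 \<Longrightarrow> cmod z \<le> s \<Longrightarrow> cmod w \<le> s \<Longrightarrow>
       cmod (moeb_app m z - moeb_app m w) \<le> shrink_factor s * cmod (moeb_app m u - moeb_app m v)"
      using pole_free_contraction[OF m(1)] by metis
    have "moeb_app m u \<in> ?K n" "moeb_app m v \<in> ?K n" using m(2) uv by force+
    then have "cmod (moeb_app m u - moeb_app m v) \<le> d n"
      using diameter_bounded_bound[OF bdd] unfolding d_def by (simp add: dist_norm)
    then have le: "shrink_factor s * cmod (moeb_app m u - moeb_app m v) \<le> shrink_factor s * d n"
      using shrink_factor_bounds(1)[OF s] by (rule mult_left_mono)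
    show ?thesis unfolding d_def[of "n + k"]
    proof (rule diameter_le)
      show "?K (n + k) \<noteq> {} \<or> 0 \<le> shrink_factor s * d n" by simp
      fix x y assume "x \<in> ?K (n + k)" "y \<in> ?K (n + k)"
      then obtain z w where zw: "z \<in> cball 0 s" "w \<in> cball 0 s"
        "x = compseq moeb_app f n z" "y = compseq moeb_app f n w"
        using n unfolding compseq_add image_comp[symmetric] by blast
      then have "x = moeb_app m z" "y = moeb_app m w" "cmod z \<le> s" "cmod w \<le> s"
        using m(2) s by auto
      then show "norm (x - y) \<le> shrink_factor s * d n" using uv(3)[OF s] le by fastforce
    qed
  qed
  \<comment> \<open>Passing to the limit of the decreasing diameters replaces counting contractions,
    so overlapping blocks cause no difficulty.\<close>
  have "L \<le> shrink_factor s * L"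
  proof (rule field_le_epsilon)
    fix e :: real assume e: "e > 0"
    then obtain N where N: "\<And>n. n \<ge> N \<Longrightarrow> d n < L + e"
      using order_tendstoD(2)[OF L(1), of "L + e"] unfolding eventually_sequentially by auto
    obtain n where n: "n > N" "compseq moeb_app (\<lambda>i. f (n + i)) k ` cball 0 1 \<subseteq> cball 0 s"
      using inf unfolding infinite_nat_iff_unbounded by blast
    have "L \<le> shrink_factor s * d n" using L(2)[of "n + k"] contract[OF n(2)] by linarith
    also have "\<dots> \<le> shrink_factor s * (L + e)"
      using N[of n] n(1) shrink_factor_bounds(1)[OF s] by (intro mult_left_mono) auto
    also have "\<dots> \<le> shrink_factor s * L + e"
      using mult_right_mono[of "shrink_factor s" 1 e] shrink_factor_bounds[OF s] e by (simp add: distrib_left)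
    finally show "L \<le> shrink_factor s * L + e" .
  qed
  then have "(1 - shrink_factor s) * L \<le> 0" by (simp add: left_diff_distrib)
  then have "L = 0" using shrink_factor_bounds[OF s] L0 by (simp add: mult_le_0_iff)
  show ?thesis
  proof (rule limit_point_typeI[OF MD])
    fix e :: real assume "e > 0"
    then obtain n where "d n < e"
      using order_tendstoD(2)[OF L(1), of e] \<open>L = 0\<close> unfolding eventually_sequentially by auto
    then have "\<forall>z\<in>cball 0 1. \<forall>w\<in>cball 0 1.
        dist (compseq moeb_app f n z) (compseq moeb_app f n w) < e"
      using diameter_bounded_bound[OF bdd] unfolding d_def by (meson imageI le_less_trans)
    then show "\<exists>n. \<forall>z\<in>cball 0 1. \<forall>w\<in>cball 0 1.
        dist (compseq moeb_app f n z) (compseq moeb_app f n w) < e" by blast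
  qed auto
qed

text \<open>By compactness each pair in \<open>Q\<close> maps into some smaller closed disc, and
  finitely many pairs share one radius; hence such pairs occur only finitely often. For any other
  pair a point reaching the circle must stay on the circle throughout, which identifies both
  tangency points.\<close>

lemma eventually_tangent_chain:
  assumes fin: "finite \<F>" and MD: "\<F> \<subseteq> MD" and f: "\<And>n. n \<ge> 1 \<Longrightarrow> f n \<in> \<F>"
    and nlp: "\<not> limit_point_type (compseq moeb_app f)"
  obtains N where "\<And>n. n > N \<Longrightarrow> cmod (alpha (f n)) = 1"
    "\<And>n. n > N \<Longrightarrow> moeb_app (f (Suc n)) (alpha (f (Suc n))) = alpha (f n)"
proof -
  have fMD: "f n \<in> MD" if "n \<ge> 1" for n using f MD that by blast
  define Q where "Q = {(g, h). g \<in> \<F> \<and> h \<in> \<F> \<and>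
     (moeb_app g \<circ> moeb_app h) ` cball 0 1 \<subseteq> ball 0 1}"
  have "finite Q" by (rule finite_subset[of _ "\<F> \<times> \<F>"]) (auto simp: Q_def fin)
  have "\<exists>s. 0 \<le> s \<and> s < 1 \<and> (moeb_app (fst p) \<circ> moeb_app (snd p)) ` cball 0 1 \<subseteq> cball 0 s"
    if pQ: "p \<in> Q" for p
  proof -
    obtain g h where p: "p = (g, h)" "g \<in> MD" "h \<in> MD"
      and sub: "(moeb_app g \<circ> moeb_app h) ` cball 0 1 \<subseteq> ball 0 1"
      using pQ MD unfolding Q_def by blast
    note reg = MD_pole_free_and_maps[OF p(2)] MD_pole_free_and_maps[OF p(3)]
    have "continuous_on (cball 0 1) (moeb_app g \<circ> moeb_app h)"
      using reg(4) by (intro continuous_on_compose pole_free_continuous_on reg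
          continuous_on_subset[OF pole_free_continuous_on[OF reg(1)]]) auto
    then have "continuous_on (cball 0 1) (\<lambda>z. cmod ((moeb_app g \<circ> moeb_app h) z))"
      by (rule continuous_on_norm)
    then obtain x where x: "x \<in> cball 0 1"
      "\<forall>z\<in>cball 0 1. cmod ((moeb_app g \<circ> moeb_app h) z) \<le> cmod ((moeb_app g \<circ> moeb_app h) x)"
      using continuous_attains_sup[of "cball (0::complex) 1"
          "\<lambda>z. cmod ((moeb_app g \<circ> moeb_app h) z)"] by auto
    have "(moeb_app g \<circ> moeb_app h) x \<in> ball 0 1" using sub x(1) by blast
    then have "cmod ((moeb_app g \<circ> moeb_app h) x) < 1" by simp
    moreover have "(moeb_app g \<circ> moeb_app h) ` cball 0 1
        \<subseteq> cball 0 (cmod ((moeb_app g \<circ> moeb_app h) x))"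
      using x(2) by (intro image_subsetI) simp
    ultimately show ?thesis unfolding p fst_conv snd_conv using norm_ge_zero by blast
  qed
  then have "\<forall>p\<in>Q. \<exists>s. 0 \<le> s \<and> s < 1 \<and>
      (moeb_app (fst p) \<circ> moeb_app (snd p)) ` cball 0 1 \<subseteq> cball 0 s" by blast
  from bchoice[OF this] obtain r where r: "\<And>p. p \<in> Q \<Longrightarrow> 0 \<le> r p \<and> r p < 1 \<and>
      (moeb_app (fst p) \<circ> moeb_app (snd p)) ` cball 0 1 \<subseteq> cball 0 (r p)" by blast
  have r01: "r p < 1" if "p \<in> Q" for p using r[OF that] by blast
  define s where "s = Max (insert 0 (r ` Q))"
  have s: "0 \<le> s" "s < 1" and rs: "\<And>p. p \<in> Q \<Longrightarrow> r p \<le> s"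
    using \<open>finite Q\<close> r01 by (auto simp: s_def)
  \<comment> \<open>The indices \<open>n + 1\<close> and \<open>n + 2\<close> give the block applied
    inside \<open>compseq moeb_app f n\<close>; they are at least 1, where \<open>f\<close> is
    constrained.\<close>
  define P where "P = {n. (f (n + 1), f (n + 2)) \<in> Q}"
  have "finite P"
  proof (rule ccontr)
    assume inf: "infinite P"
    have "P \<subseteq> {n. compseq moeb_app (\<lambda>i. f (n + i)) (Suc (Suc 0)) ` cball 0 1 \<subseteq> cball 0 s}"
    proof
      fix n assume "n \<in> P"
      then have Q: "(f (n + 1), f (n + 2)) \<in> Q" by (simp add: P_def)
      have "(moeb_app (f (n + 1)) \<circ> moeb_app (f (n + 2))) ` cball 0 1
          \<subseteq> cball 0 (r (f (n + 1), f (n + 2)))"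
        using r[OF Q] by simp
      also have "\<dots> \<subseteq> cball 0 s" by (rule subset_cball[OF rs[OF Q]])
      finally have "(moeb_app (f (n + 1)) \<circ> moeb_app (f (n + 2))) ` cball 0 1 \<subseteq> cball 0 s" .
      then have "compseq moeb_app (\<lambda>i. f (n + i)) (Suc (Suc 0)) ` cball 0 1 \<subseteq> cball 0 s"
        by simp
      then show "n \<in> {n. compseq moeb_app (\<lambda>i. f (n + i)) (Suc (Suc 0)) ` cball 0 1 \<subseteq> cball 0 s}"
        by blast
    qed
    then have "infinite {n. compseq moeb_app (\<lambda>i. f (n + i)) (Suc (Suc 0)) ` cball 0 1 \<subseteq> cball 0 s}"
      using inf finite_subset by blast
    then show False using limit_point_type_if_contracting_blocks[of f s "Suc (Suc 0)"] fMD s nlp by blast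
  qed
  then obtain N where N: "\<And>n. n \<in> P \<Longrightarrow> n < N" unfolding finite_nat_set_iff_bounded by blast
  have key: "cmod (alpha (f (n + 1))) = 1 \<and> moeb_app (f (n + 2)) (alpha (f (n + 2))) = alpha (f (n + 1))"
    if "n \<ge> N" for n
  proof -
    let ?g = "f (n + 1)" and ?h = "f (n + 2)"
    have gh: "?g \<in> MD" "?h \<in> MD" using fMD by auto
    have "n \<notin> P" using N[of n] that by linarith
    moreover have "?g \<in> \<F>" "?h \<in> \<F>" using f by simp_all
    ultimately have "\<not> (moeb_app ?g \<circ> moeb_app ?h) ` cball 0 1 \<subseteq> ball 0 1"
      unfolding P_def Q_def by blast
    then obtain z where z: "z \<in> cball 0 1" "moeb_app ?g (moeb_app ?h z) \<notin> ball 0 1"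
      unfolding image_subset_iff comp_apply by blast
    let ?w = "moeb_app ?h z"
    have w: "?w \<in> cball 0 1" by (rule MD_pole_free_and_maps(2)[OF gh(2) z(1)])
    then have "moeb_app ?g ?w \<in> cball 0 1" by (rule MD_pole_free_and_maps(2)[OF gh(1)])
    then have 1: "cmod (moeb_app ?g ?w) = 1" using z(2) by simp
    have "?w \<notin> ball 0 1" using MD_maps_ball[OF gh(1)] z(2) by blast
    then have 2: "cmod ?w = 1" using w by simp
    then have "z \<notin> ball 0 1" using MD_maps_ball[OF gh(2), of z] by auto
    then have 3: "cmod z = 1" using z(1) by simp
    have "alpha ?g = ?w" "alpha ?h = z" by (rule alpha_eq[OF gh(1) 2 1], rule alpha_eq[OF gh(2) 3 2])
    then show ?thesis using 2 by simp
  qed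
  show thesis
  proof (rule that[of N])
    fix n assume "n > N"
    then obtain k where "n = k + 1" "k \<ge> N" using that[of "n - 1"] by auto
    then show "cmod (alpha (f n)) = 1" "moeb_app (f (Suc n)) (alpha (f (Suc n))) = alpha (f n)"
      using key[of k] by auto
  qed
qed

section \<open>Poincare extension and ideal convergence\<close>

text \<open>As \<open>p / r\<close> varies, this point runs through the hyperbolic geodesic with ideal endpoints
  \<open>x\<close> and \<open>y\<close>.\<close>
definition geod_pt :: "real \<Rightarrow> real \<Rightarrow> complex \<Rightarrow> complex \<Rightarrow> complex \<times> real" where
  "geod_pt p r x y = ((of_real p * x + of_real r * y) / of_real (p + r),
     sqrt (p * r) * cmod (x - y) / (p + r))"

text \<open>On a geodesic this collapses the denominator of the Poincare extension to a weighted
  mean of the squared denominators at the two endpoints.\<close>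

lemma cmod_weighted_sum:
  "(cmod (of_real p * X + of_real r * Y))\<^sup>2 + p * r * (cmod (X - Y))\<^sup>2
    = (p + r) * (p * (cmod X)\<^sup>2 + r * (cmod Y)\<^sup>2)"
  unfolding cmod_power2 by (simp add: algebra_simps power2_eq_square)

text \<open>In the model by positive Hermitian matrices, \<open>geod_pt p r x y\<close> is the sum
  of the rank-one matrices of \<open>(x, 1)\<close> and \<open>(y, 1)\<close> with weights
  \<open>p\<close> and \<open>r\<close>. The coefficient matrix sends \<open>(x, 1)\<close> to
  \<open>moeb_den m x\<close> times \<open>(moeb_app m x, 1)\<close>, which explains the new
  weights.\<close>

lemma poinc_geod_pt:
  assumes "p > 0" "r > 0" "moeb_den m x \<noteq> 0" "moeb_den m y \<noteq> 0"
  shows "poinc m (geod_pt p r x y) =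
    geod_pt (p * (cmod (moeb_den m x))\<^sup>2) (r * (cmod (moeb_den m y))\<^sup>2) (moeb_app m x) (moeb_app m y)"
proof -
  obtain a b c d where m: "m = (a,b,c,d)" by (metis prod_cases4)
  define X where "X = c * x + d"
  define Y where "Y = c * y + d"
  define A where "A = a * x + b"
  define B where "B = a * y + b"
  define S where "S = p + r"
  define z where "z = (of_real p * x + of_real r * y) / of_real S"
  define t where "t = sqrt (p * r) * cmod (x - y) / S"
  have XY: "moeb_den m x = X" "moeb_den m y = Y" by (simp_all add: m moeb_den_def X_def Y_def)
  have nz: "X \<noteq> 0" "Y \<noteq> 0" using assms XY by simp_all
  have AB: "moeb_app m x = A / X" "moeb_app m y = B / Y"
    by (simp_all add: m moeb_app_def X_def Y_def A_def B_def)
  have S: "S > 0" using assms by (simp add: S_def)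
  have cS: "complex_of_real S \<noteq> 0" using S by simp
  define W where "W = p * (cmod X)\<^sup>2 + r * (cmod Y)\<^sup>2"
  have W: "W > 0" unfolding W_def using assms nz by (intro add_pos_pos mult_pos_pos) auto
  have t2: "t\<^sup>2 = p * r * (cmod (x - y))\<^sup>2 / S\<^sup>2"
    unfolding t_def using assms by (simp add: power_divide power_mult_distrib)
  have czd: "c * z + d = (of_real p * X + of_real r * Y) / of_real S"
    unfolding z_def X_def Y_def using cS by (simp add: field_simps S_def)
  have azb: "a * z + b = (of_real p * A + of_real r * B) / of_real S"
    unfolding z_def A_def B_def using cS by (simp add: field_simps S_def)
  have cxy: "c * (x - y) = X - Y" "a * (x - y) = A - B"
    by (simp_all add: X_def Y_def A_def B_def algebra_simps)
  define D where "D = (cmod (c*z + d))\<^sup>2 + (cmod c)\<^sup>2 * t\<^sup>2"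
  have "D = ((cmod (of_real p * X + of_real r * Y))\<^sup>2 + p * r * (cmod (X - Y))\<^sup>2) / S\<^sup>2"
  proof -
    have "(cmod (c*z + d))\<^sup>2 = (cmod (of_real p * X + of_real r * Y))\<^sup>2 / S\<^sup>2"
      unfolding czd by (simp only: norm_divide power_divide norm_of_real power2_abs)
    moreover have "(cmod c)\<^sup>2 * t\<^sup>2 = p * r * (cmod (X - Y))\<^sup>2 / S\<^sup>2"
      unfolding t2 cxy(1)[symmetric] norm_mult power_mult_distrib by simp
    ultimately show ?thesis unfolding D_def by (simp only: add_divide_distrib)
  qed
  also have "\<dots> = W / S"
    unfolding cmod_weighted_sum W_def[symmetric] S_def[symmetric] using S by (simp add: power2_eq_square)
  finally have D: "D = W / S" .
  have "of_real ((cmod (x - y))\<^sup>2) = (x - y) * cnj (x - y)" by (rule complex_norm_square)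
  then have "a * cnj c * of_real (t\<^sup>2) = of_real (p * r) * ((a * (x - y)) * cnj (c * (x - y))) / (of_real S)\<^sup>2"
    unfolding t2 by (simp add: mult_ac)
  then have act: "a * cnj c * of_real (t\<^sup>2) = of_real (p * r) * ((A - B) * cnj (X - Y)) / (of_real S)\<^sup>2"
    unfolding cxy .
  have frac: "U / of_real S * cnj (V / of_real S) + W' / (of_real S)\<^sup>2
      = (U * cnj V + W') / (of_real S)\<^sup>2" for U V W'
    by (simp add: add_divide_distrib power2_eq_square)
  have "(a*z + b) * cnj (c*z + d) + a * cnj c * of_real (t\<^sup>2)
      = ((of_real p * A + of_real r * B) * cnj (of_real p * X + of_real r * Y)
         + of_real (p * r) * ((A - B) * cnj (X - Y))) / (of_real S)\<^sup>2"
    unfolding act czd azb by (rule frac)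
  also have "(of_real p * A + of_real r * B) * cnj (of_real p * X + of_real r * Y)
         + of_real (p * r) * ((A - B) * cnj (X - Y))
      = of_real S * (of_real p * (A * cnj X) + of_real r * (B * cnj Y))"
    by (simp add: S_def algebra_simps)
  finally have N: "(a*z + b) * cnj (c*z + d) + a * cnj c * of_real (t\<^sup>2)
      = (of_real p * (A * cnj X) + of_real r * (B * cnj Y)) / of_real S"
    using cS by (simp add: power2_eq_square)
  have conj: "of_real ((cmod X)\<^sup>2) * (A / X) = A * cnj X" "of_real ((cmod Y)\<^sup>2) * (B / Y) = B * cnj Y"
    unfolding complex_norm_square using nz by simp_all
  have 1: "((a*z + b) * cnj (c*z + d) + a * cnj c * of_real (t\<^sup>2)) / of_real D
      = (of_real (p * (cmod X)\<^sup>2) * (A / X) + of_real (r * (cmod Y)\<^sup>2) * (B / Y)) / of_real W"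
    unfolding N D unfolding of_real_mult mult.assoc conj using cS W by simp
  have "cmod (A / X - B / Y) = cmod (a*d - b*c) * cmod (x - y) / (cmod X * cmod Y)"
    using moeb_app_diff[OF assms(3,4)] unfolding AB XY
    by (simp add: norm_mult norm_divide m moeb_det_def)
  moreover have "sqrt (p * (cmod X)\<^sup>2 * (r * (cmod Y)\<^sup>2)) = sqrt (p * r) * (cmod X * cmod Y)"
    using assms by (simp add: real_sqrt_mult mult_ac)
  ultimately have "sqrt (p * (cmod X)\<^sup>2 * (r * (cmod Y)\<^sup>2)) * cmod (A / X - B / Y)
      = sqrt (p * r) * cmod (a*d - b*c) * cmod (x - y)"
    using nz by simp
  then have 2: "cmod (a*d - b*c) * t / D =
      sqrt (p * (cmod X)\<^sup>2 * (r * (cmod Y)\<^sup>2)) * cmod (A / X - B / Y) / W"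
    unfolding t_def D using S by simp
  have "geod_pt p r x y = (z, t)" by (simp add: geod_pt_def z_def t_def S_def)
  then have "poinc m (geod_pt p r x y) =
      (((a*z + b) * cnj (c*z + d) + a * cnj c * of_real (t\<^sup>2)) / of_real D, cmod (a*d - b*c) * t / D)"
    by (simp add: poinc_def m D_def Let_def)
  also have "\<dots> = geod_pt (p * (cmod X)\<^sup>2) (r * (cmod Y)\<^sup>2) (A / X) (B / Y)"
    unfolding 1 2 by (simp add: geod_pt_def W_def)
  finally show ?thesis unfolding XY AB .
qed

text \<open>Each further map is applied innermost, so the induction runs over all endpoints and
  weights. Only positivity of the weights is retained, because the later estimates are uniform in
  them.\<close>

lemma compseq_poinc_geod_pt:
  assumes "\<And>n. n \<ge> 1 \<Longrightarrow> f n \<in> MD" "p > 0" "r > 0" "x \<in> cball 0 1" "y \<in> cball 0 1"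
  shows "\<exists>p'>0. \<exists>r'>0. compseq poinc f n (geod_pt p r x y) =
    geod_pt p' r' (compseq moeb_app f n x) (compseq moeb_app f n y)"
  using assms(2-5)
proof (induction n arbitrary: p r x y)
  case 0
  then show ?case by auto
next
  case (Suc n)
  let ?g = "f (Suc n)"
  have g: "?g \<in> MD" using assms(1) by simp
  have den: "moeb_den ?g x \<noteq> 0" "moeb_den ?g y \<noteq> 0"
    using MD_pole_free_and_maps(1)[OF g] Suc.prems(3,4) unfolding pole_free_def by blast+
  let ?p = "p * (cmod (moeb_den ?g x))\<^sup>2" and ?r = "r * (cmod (moeb_den ?g y))\<^sup>2"
  have "?p > 0" "?r > 0" using Suc.prems den by simp_all
  then obtain p' r' where "p' > 0" "r' > 0"
    "compseq poinc f n (geod_pt ?p ?r (moeb_app ?g x) (moeb_app ?g y)) =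
      geod_pt p' r' (compseq moeb_app f n (moeb_app ?g x)) (compseq moeb_app f n (moeb_app ?g y))"
    using Suc.IH MD_pole_free_and_maps(2)[OF g Suc.prems(3)] MD_pole_free_and_maps(2)[OF g Suc.prems(4)]
    by blast
  then show ?case
    using poinc_geod_pt[OF Suc.prems(1,2) den] by auto
qed

text \<open>The horizontal part is a convex combination of the endpoints, and the
  arithmetic-geometric mean inequality bounds the height. Neither bound depends on the
  weights.\<close>

lemma geod_pt_near_endpoint:
  assumes "p > 0" "r > 0" "geod_pt p r x y = (z, t)"
  shows "cmod (z - x) \<le> cmod (x - y)" "t \<le> cmod (x - y)" "x \<noteq> y \<Longrightarrow> 0 < t"
proof -
  have t: "t = sqrt (p * r) / (p + r) * cmod (x - y)"
    and z: "z = (of_real p * x + of_real r * y) / of_real (p + r)"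
    using assms(3) by (simp_all add: geod_pt_def)
  have "complex_of_real (p + r) \<noteq> 0" using assms(1,2) by (simp del: of_real_add)
  then have "z - x = of_real (r / (p + r)) * (y - x)"
    unfolding z by (simp add: field_simps)
  then have "cmod (z - x) = r / (p + r) * cmod (x - y)"
    using assms(1,2) by (simp add: norm_mult norm_divide norm_minus_commute del: of_real_add of_real_divide)
  moreover have "r / (p + r) \<le> 1" using assms(1,2) by simp
  ultimately show "cmod (z - x) \<le> cmod (x - y)"
    using mult_right_mono[of "r / (p + r)" 1 "cmod (x - y)"] by simp
  have "sqrt (p * r) \<le> (p + r) / 2" using assms(1,2) by (intro arith_geo_mean_sqrt) auto
  then have "sqrt (p * r) / (p + r) \<le> 1" using assms(1,2) by simp
  then show "t \<le> cmod (x - y)"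
    unfolding t using mult_right_mono[of "sqrt (p * r) / (p + r)" 1 "cmod (x - y)"] by simp
  show "0 < t" if "x \<noteq> y" unfolding t using assms(1,2) that by simp
qed

lemma conv_ideallyI:
  assumes z: "(\<lambda>n. fst (G n jpt)) \<longlonglongrightarrow> q" and t: "(\<lambda>n. snd (G n jpt)) \<longlonglongrightarrow> 0"
    and pos: "\<And>n. snd (G n jpt) > 0"
  shows "conv_ideally G q"
proof -
  define w where "w n = fst (G n jpt)" for n
  define s where "s n = snd (G n jpt)" for n
  have G: "G n jpt = (w n, s n)" for n by (simp add: w_def s_def)
  have w: "w \<longlonglongrightarrow> q" and s: "s \<longlonglongrightarrow> 0" and s0: "s n > 0" for n
    using z t pos unfolding w_def s_def by simp_all
  have "filterlim (\<lambda>n. inverse (s n)) at_top sequentially"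
    using s s0 by (intro filterlim_inverse_at_top) simp_all
  then have "filterlim (\<lambda>n. (1/8) * inverse (s n)) at_top sequentially"
    by (intro filterlim_tendsto_pos_mult_at_top[OF tendsto_const]) simp_all
  \<comment> \<open>Once \<open>s n < 1/2\<close>, the square \<open>(1 - s n)\<^sup>2\<close> is at
    least 1/4; division by \<open>2 * s n\<close> gives the 1/8.\<close>
  moreover have "\<forall>\<^sub>F n in sequentially. (1/8) * inverse (s n)
      \<le> 1 + ((cmod (0 - w n))\<^sup>2 + (1 - s n)\<^sup>2) / (2 * 1 * s n)"
  proof -
    have "\<forall>\<^sub>F n in sequentially. s n < 1/2" by (rule order_tendstoD(2)[OF s]) simp
    then show ?thesis
    proof eventually_elim
      case (elim n)
      have "(1/2)\<^sup>2 \<le> (1 - s n)\<^sup>2" using elim by (intro power_mono) simp_all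
      moreover have "(1/2::real)\<^sup>2 = 1/4" by (simp add: power_divide)
      ultimately have "1/4 \<le> (cmod (0 - w n))\<^sup>2 + (1 - s n)\<^sup>2"
        using zero_le_power2[of "cmod (0 - w n)"] by linarith
      then have "(1/4) / (2 * 1 * s n) \<le> ((cmod (0 - w n))\<^sup>2 + (1 - s n)\<^sup>2) / (2 * 1 * s n)"
        using s0[of n] by (intro divide_right_mono) simp_all
      moreover have "(1/4) / (2 * 1 * s n) = (1/8) * inverse (s n)" by (simp add: field_simps)
      ultimately show ?case by linarith
    qed
  qed
  ultimately have "filterlim (\<lambda>n. 1 + ((cmod (0 - w n))\<^sup>2 + (1 - s n)\<^sup>2) / (2 * 1 * s n)) at_top sequentially"
    by (rule filterlim_at_top_mono)
  then have 1: "filterlim (\<lambda>n. hdist jpt (G n jpt)) at_top sequentially"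
    unfolding G unfolding hdist_def jpt_def prod.case by (rule filterlim_compose[OF arcosh_real_at_top])
  have "(\<lambda>n. 2 * sqrt ((cmod (w n - q))\<^sup>2 + (s n - 0)\<^sup>2)) \<longlonglongrightarrow> 2 * sqrt ((cmod (q - q))\<^sup>2 + (0 - 0)\<^sup>2)"
    by (intro tendsto_intros w s)
  then have lim: "(\<lambda>n. 2 * sqrt ((cmod (w n - q))\<^sup>2 + (s n - 0)\<^sup>2)) \<longlonglongrightarrow> 0" by simp
  have "(\<lambda>n. chordal3 (G n jpt) (q, 0)) \<longlonglongrightarrow> 0"
  proof (rule tendsto_sandwich[OF _ _ tendsto_const lim])
    show "\<forall>\<^sub>F n in sequentially. 0 \<le> chordal3 (G n jpt) (q, 0)"
      unfolding chordal3_def G prod.case by (intro always_eventually allI divide_nonneg_nonneg) simp_all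
    have "2 * sqrt ((cmod (w n - q))\<^sup>2 + (s n - 0)\<^sup>2) / sqrt ((1 + (cmod (w n))\<^sup>2 + (s n)\<^sup>2) * (1 + (cmod q)\<^sup>2 + 0\<^sup>2))
        \<le> 2 * sqrt ((cmod (w n - q))\<^sup>2 + (s n - 0)\<^sup>2) / 1" for n
    proof (rule divide_left_mono)
      have "1 * 1 \<le> (1 + (cmod (w n))\<^sup>2 + (s n)\<^sup>2) * (1 + (cmod q)\<^sup>2 + 0\<^sup>2)"
        by (intro mult_mono) simp_all
      then show "1 \<le> sqrt ((1 + (cmod (w n))\<^sup>2 + (s n)\<^sup>2) * (1 + (cmod q)\<^sup>2 + 0\<^sup>2))" by simp
      then show "0 < sqrt ((1 + (cmod (w n))\<^sup>2 + (s n)\<^sup>2) * (1 + (cmod q)\<^sup>2 + 0\<^sup>2)) * 1" by linarith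
    qed simp
    then show "\<forall>\<^sub>F n in sequentially. chordal3 (G n jpt) (q, 0) \<le> 2 * sqrt ((cmod (w n - q))\<^sup>2 + (s n - 0)\<^sup>2)"
      unfolding chordal3_def G prod.case by (intro always_eventually allI) simp
  qed
  with 1 show ?thesis by (simp add: conv_ideally_def)
qed

text \<open>The point \<open>j\<close> lies on the geodesic from \<open>u\<close> to \<open>-u\<close>, and its image lies within
  Euclidean distance \<open>\<bar>F\<^sub>n u - F\<^sub>n (-u)\<bar>\<close> of either ideal endpoint of the image geodesic.\<close>
lemma conv_ideally_if_antipodal:
  assumes MD: "\<And>n. n \<ge> 1 \<Longrightarrow> f n \<in> MD" and u: "cmod u = 1"
    and lim: "(\<lambda>n. compseq moeb_app f n u) \<longlonglongrightarrow> q" "(\<lambda>n. compseq moeb_app f n (- u)) \<longlonglongrightarrow> q"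
  shows "conv_ideally (compseq poinc f) q"
proof -
  let ?x = "\<lambda>n. compseq moeb_app f n u" and ?y = "\<lambda>n. compseq moeb_app f n (- u)"
  let ?z = "\<lambda>n. fst (compseq poinc f n jpt)" and ?t = "\<lambda>n. snd (compseq poinc f n jpt)"
  have uu: "u \<in> cball 0 1" "- u \<in> cball 0 1" "u \<noteq> - u" using u by (auto simp: eq_neg_iff_add_eq_0)
  have "cmod (u + u) = 2" using u by (simp add: mult_2[symmetric] norm_mult)
  then have j: "jpt = geod_pt 1 1 u (- u)" by (simp add: jpt_def geod_pt_def)
  have near: "cmod (?z n - ?x n) \<le> cmod (?x n - ?y n)" "0 < ?t n" "?t n \<le> cmod (?x n - ?y n)" for n
  proof -
    \<comment> \<open>Distinct endpoints keep the image of \<open>j\<close> at positive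
      height.\<close>
    have ne: "?x n \<noteq> ?y n"
      using inj_onD[OF compseq_inj_on[of f n]] MD uu by blast
    obtain p r where "p > 0" "r > 0" "compseq poinc f n (geod_pt 1 1 u (- u)) = geod_pt p r (?x n) (?y n)"
      using compseq_poinc_geod_pt[of f 1 1 u "- u" n] MD uu by auto
    then have pr: "p > 0" "r > 0" "geod_pt p r (?x n) (?y n) = (?z n, ?t n)" unfolding j by simp_all
    note h = geod_pt_near_endpoint[OF pr]
    show "cmod (?z n - ?x n) \<le> cmod (?x n - ?y n)" "0 < ?t n" "?t n \<le> cmod (?x n - ?y n)"
      using h(1) h(3)[OF ne] h(2) by simp_all
  qed
  have "(\<lambda>n. cmod (?x n - ?y n)) \<longlonglongrightarrow> cmod (q - q)" by (intro tendsto_intros lim)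
  then have d: "(\<lambda>n. cmod (?x n - ?y n)) \<longlonglongrightarrow> 0" by simp
  have "?t \<longlonglongrightarrow> 0"
    by (rule tendsto_sandwich[OF _ _ tendsto_const d]) (use near in \<open>simp_all add: less_imp_le\<close>)
  moreover have "(\<lambda>n. ?z n - ?x n) \<longlonglongrightarrow> 0"
    by (rule Lim_null_comparison[OF _ d]) (use near in simp)
  then have "(\<lambda>n. (?z n - ?x n) + ?x n) \<longlonglongrightarrow> 0 + q" by (intro tendsto_add lim)
  then have "?z \<longlonglongrightarrow> q" by simp
  ultimately show ?thesis using near by (intro conv_ideallyI)
qed

section \<open>Comparison of chordal and Euclidean distance\<close>

lemma chordal_le: "chordal z w \<le> 2 * dist z w"
proof -
  have "1 * 1 \<le> (1 + (cmod z)\<^sup>2) * (1 + (cmod w)\<^sup>2)" by (intro mult_mono) simp_all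
  then have 1: "1 \<le> sqrt ((1 + (cmod z)\<^sup>2) * (1 + (cmod w)\<^sup>2))" by simp
  then have "2 * cmod (z - w) / sqrt ((1 + (cmod z)\<^sup>2) * (1 + (cmod w)\<^sup>2)) \<le> 2 * cmod (z - w) / 1"
    by (intro divide_left_mono) simp_all
  then show ?thesis by (simp add: chordal_def dist_norm)
qed

lemma dist_le_chordal:
  assumes "z \<in> cball 0 1" "w \<in> cball 0 1"
  shows "dist z w \<le> chordal z w"
proof -
  have zw: "(cmod z)\<^sup>2 \<le> 1" "(cmod w)\<^sup>2 \<le> 1" using assms by (simp_all add: abs_square_le_1)
  then have "(1 + (cmod z)\<^sup>2) * (1 + (cmod w)\<^sup>2) \<le> 2 * 2" by (intro mult_mono) simp_all
  then have 1: "sqrt ((1 + (cmod z)\<^sup>2) * (1 + (cmod w)\<^sup>2)) \<le> 2"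
    by (intro real_le_lsqrt) simp_all
  have "0 < (1 + (cmod z)\<^sup>2) * (1 + (cmod w)\<^sup>2)"
    by (intro mult_pos_pos add_pos_nonneg) simp_all
  then have "2 * cmod (z - w) / 2 \<le> 2 * cmod (z - w) / sqrt ((1 + (cmod z)\<^sup>2) * (1 + (cmod w)\<^sup>2))"
    using 1 by (intro divide_left_mono) simp_all
  then show ?thesis by (simp add: chordal_def dist_norm)
qed

section \<open>Chains of tangent maps\<close>

text \<open>By \<open>chain\<close>, the Cayley transform at the target of \<open>g (Suc k)\<close>
  is the one at the source of \<open>g k\<close>, so the affine forms compose: \<kappa> is the
  product of the slopes, and \<mu> accumulates translations scaled by the preceding product. The map
  \<open>g 0\<close> is not part of the composite; it contributes its tangency point as the final
  target.\<close>

lemma tangent_chain_affine: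
  assumes fin: "finite \<F>" and sub: "\<F> \<subseteq> MD" and g: "\<And>k. g k \<in> \<F>"
    and sph: "\<And>k. cmod (alpha (g k)) = 1"
    and chain: "\<And>k. moeb_app (g (Suc k)) (alpha (g (Suc k))) = alpha (g k)"
  obtains \<kappa> :: "nat \<Rightarrow> real" and \<mu> :: "nat \<Rightarrow> complex" and \<epsilon> M :: real where
    "\<epsilon> > 0" "\<mu> 0 = 0" "\<And>k. \<kappa> k > 0"
    "\<And>k. Re (\<mu> (Suc k) - \<mu> k) \<ge> \<epsilon> * \<kappa> k" "\<And>k. cmod (\<mu> (Suc k) - \<mu> k) \<le> M * \<kappa> k"
    "\<And>k. compseq moeb_app g k (alpha (g k)) = alpha (g 0)"
    "\<And>k z. z \<in> cball 0 1 \<Longrightarrow> z \<noteq> alpha (g k) \<Longrightarrow>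
       compseq moeb_app g k z \<noteq> alpha (g 0) \<and>
       cayley (alpha (g 0)) (compseq moeb_app g k z) = of_real (\<kappa> k) * cayley (alpha (g k)) z + \<mu> k"
proof -
  have gMD: "g k \<in> MD" for k using g sub by blast
  define T where "T = {m \<in> \<F>. cmod (alpha m) = 1 \<and> cmod (moeb_app m (alpha m)) = 1}"
  have "finite T" using fin by (simp add: T_def)
  have gT: "g (Suc k) \<in> T" for k using g sph chain by (simp add: T_def)
  let ?P = "\<lambda>m (s::real, \<tau>). s > 0 \<and> Re \<tau> > 0 \<and> (\<forall>z\<in>cball 0 1. z \<noteq> alpha m \<longrightarrow>
       cayley (moeb_app m (alpha m)) (moeb_app m z) = of_real s * cayley (alpha m) z + \<tau>)"
  have "\<forall>m\<in>T. \<exists>p. ?P m p"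
  proof
    fix m assume "m \<in> T"
    then have "m \<in> MD" "cmod (alpha m) = 1" "cmod (moeb_app m (alpha m)) = 1"
      using sub by (auto simp: T_def)
    then show "\<exists>p. ?P m p"
    proof (rule MD_cayley_affine)
      fix s \<tau>
      assume "s > 0" "Re \<tau> > 0" "\<And>z. z \<in> cball 0 1 \<Longrightarrow> z \<noteq> alpha m \<Longrightarrow>
        cayley (moeb_app m (alpha m)) (moeb_app m z) = of_real s * cayley (alpha m) z + \<tau>"
      then have "?P m (s, \<tau>)" unfolding prod.case by (intro conjI ballI impI)
      then show ?thesis by blast
    qed
  qed
  from bchoice[OF this] obtain h where "\<forall>m\<in>T. ?P m (h m)" ..
  note h = bspec[OF this]
  define s where "s k = fst (h (g k))" for k
  define \<tau> where "\<tau> k = snd (h (g k))" for k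
  have st: "s (Suc k) > 0" "Re (\<tau> (Suc k)) > 0"
    "\<And>z. z \<in> cball 0 1 \<Longrightarrow> z \<noteq> alpha (g (Suc k)) \<Longrightarrow>
      cayley (alpha (g k)) (moeb_app (g (Suc k)) z)
        = of_real (s (Suc k)) * cayley (alpha (g (Suc k))) z + \<tau> (Suc k)" for k
  proof -
    have "?P (g (Suc k)) (s (Suc k), \<tau> (Suc k))"
      unfolding s_def \<tau>_def prod.collapse by (rule h[OF gT])
    note P = this[unfolded prod.case chain]
    show "s (Suc k) > 0" "Re (\<tau> (Suc k)) > 0" using P by (rule conjunct1, elim conjE)
    show "cayley (alpha (g k)) (moeb_app (g (Suc k)) z)
        = of_real (s (Suc k)) * cayley (alpha (g (Suc k))) z + \<tau> (Suc k)"
      if "z \<in> cball 0 1" "z \<noteq> alpha (g (Suc k))" for z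
      using P that by (elim conjE) (drule bspec, assumption, elim impE)
  qed
  \<comment> \<open>Together with \<open>M\<close> below, the extreme translation parts over the
    finite set \<open>T\<close>; positivity of \<epsilon> rests on each map having
    \<open>Re \<tau> > 0\<close>.\<close>
  define \<epsilon> where "\<epsilon> = Min (insert 1 ((\<lambda>m. Re (snd (h m))) ` T))"
  define M where "M = Max (insert 0 ((\<lambda>m. cmod (snd (h m))) ` T))"
  have "Re (snd (h m)) > 0" if "m \<in> T" for m
    using h[OF that] unfolding case_prod_beta by (elim conjE)
  then have eps: "\<epsilon> > 0" unfolding \<epsilon>_def using \<open>finite T\<close> by simp
  have eps_le: "\<epsilon> \<le> Re (\<tau> (Suc k))" for k
    unfolding \<epsilon>_def \<tau>_def using \<open>finite T\<close> gT by (intro Min_le) auto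
  have le_M: "cmod (\<tau> (Suc k)) \<le> M" for k
    unfolding M_def \<tau>_def using \<open>finite T\<close> gT by (intro Max_ge) auto
  define \<kappa> where "\<kappa> k = (\<Prod>i<k. s (Suc i))" for k
  define \<mu> where "\<mu> k = (\<Sum>i<k. of_real (\<kappa> i) * \<tau> (Suc i))" for k
  have lam: "\<kappa> k > 0" for k unfolding \<kappa>_def using st(1) by (intro prod_pos) simp
  have mu: "\<mu> (Suc k) - \<mu> k = of_real (\<kappa> k) * \<tau> (Suc k)" for k by (simp add: \<mu>_def)
  have base: "compseq moeb_app g k (alpha (g k)) = alpha (g 0)" for k
    by (induction k) (simp_all add: chain)
  have aff: "cayley (alpha (g 0)) (compseq moeb_app g k z) = of_real (\<kappa> k) * cayley (alpha (g k)) z + \<mu> k"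
    if "z \<in> cball 0 1" "z \<noteq> alpha (g k)" for k z
    using that
  proof (induction k arbitrary: z)
    case 0
    then show ?case by (simp add: \<kappa>_def \<mu>_def)
  next
    case (Suc k)
    let ?w = "moeb_app (g (Suc k)) z"
    have w: "?w \<in> cball 0 1" by (rule MD_pole_free_and_maps(2)[OF gMD Suc.prems(1)])
    \<comment> \<open>Off its tangency point the map lands inside the disc, hence away from the next
      tangency point, as the induction hypothesis requires.\<close>
    have "cmod ?w < 1"
      by (rule MD_tangent_unique[OF gMD sph _ Suc.prems]) (simp add: chain sph)
    then have "?w \<noteq> alpha (g k)" using sph[of k] by auto
    from Suc.IH[OF w this] show ?case
      unfolding st(3)[OF Suc.prems] using mu[of k] by (simp add: \<kappa>_def algebra_simps)
  qed
  show thesis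
  proof (rule that[of \<epsilon> \<mu> \<kappa> M, OF eps _ lam _ _ base])
    show "\<mu> 0 = 0" by (simp add: \<mu>_def)
    show "\<epsilon> * \<kappa> k \<le> Re (\<mu> (Suc k) - \<mu> k)" for k
      unfolding mu using mult_left_mono[OF eps_le[of k], of "\<kappa> k"] lam[of k] by (simp add: mult.commute)
    show "cmod (\<mu> (Suc k) - \<mu> k) \<le> M * \<kappa> k" for k
      unfolding mu norm_mult using mult_left_mono[OF le_M[of k], of "\<kappa> k"] lam[of k]
      by (simp add: mult.commute)
    fix k z assume z: "z \<in> cball 0 1" "z \<noteq> alpha (g k)"
    have "alpha (g k) \<in> cball 0 1" using sph by simp
    then have "compseq moeb_app g k z \<noteq> compseq moeb_app g k (alpha (g k))"
      using inj_onD[OF compseq_inj_on[of g k, OF gMD] _ z(1)] z(2) by blast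
    then show "compseq moeb_app g k z \<noteq> alpha (g 0) \<and>
       cayley (alpha (g 0)) (compseq moeb_app g k z) = of_real (\<kappa> k) * cayley (alpha (g k)) z + \<mu> k"
      using aff[OF z] unfolding base by blast
  qed
qed

lemma Re_cayley_nonneg:
  assumes "cmod \<alpha> = 1" "z \<in> cball 0 1"
  shows "Re (cayley \<alpha> z) \<ge> 0"
proof -
  have "(cmod z)\<^sup>2 \<le> 1" using assms(2) by (simp add: abs_square_le_1)
  then show ?thesis unfolding Re_cayley[OF assms(1)] by simp
qed

text \<open>A half-plane far to the right corresponds to a small horodisc at \<alpha>, because
  \<open>cayley \<alpha> z + 1 = 2 * \<alpha> / (\<alpha> - z)\<close>.\<close>

lemma dist_le_Re_cayley:
  assumes "cmod \<alpha> = 1" "z \<noteq> \<alpha>" "Re (cayley \<alpha> z) \<ge> C" "C > 0"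
  shows "dist z \<alpha> \<le> 2 / C"
proof -
  have az: "\<alpha> - z \<noteq> 0" using assms(2) by simp
  have "cayley \<alpha> z + 1 = 2 * \<alpha> / (\<alpha> - z)"
    unfolding cayley_def using az by (simp add: field_simps)
  then have "cmod (cayley \<alpha> z + 1) = 2 / cmod (\<alpha> - z)"
    using assms(1) by (simp add: norm_mult norm_divide)
  moreover have "C \<le> cmod (cayley \<alpha> z + 1)"
    using complex_Re_le_cmod[of "cayley \<alpha> z + 1"] assms(3) by simp
  ultimately have "C \<le> 2 / cmod (\<alpha> - z)" by simp
  then have "cmod (\<alpha> - z) \<le> 2 / C" using az assms(4) by (simp add: field_simps)
  then show ?thesis by (simp add: dist_norm norm_minus_commute)
qed

lemma cmod_cayley_le:
  assumes "cmod \<alpha> = 1" "cmod z \<le> 1" "e > 0" "dist z \<alpha> \<ge> e"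
  shows "cmod (cayley \<alpha> z) \<le> 2 / e"
proof -
  have "cmod (\<alpha> + z) \<le> 2" using norm_triangle_ineq[of \<alpha> z] assms by simp
  moreover have "e \<le> cmod (\<alpha> - z)" using assms(4) by (simp add: dist_norm norm_minus_commute)
  ultimately show ?thesis unfolding cayley_def norm_divide using assms(3) by (intro frac_le) simp_all
qed

text \<open>Convergence is stated off a neighbourhood of \<open>alpha (f n)\<close>, which moves
  with \<open>n\<close>, and uniformly in its position. The point \<open>p\<close> is the constant
  image of these tangency points; \<open>p \<noteq> q\<close> is what later rules out convergence to
  \<open>q\<close> on \<open>X\<close>.\<close>

lemma limit_disc_convergence:
  assumes fin: "finite \<F>" and sub: "\<F> \<subseteq> MD" and f: "\<And>n. n \<ge> 1 \<Longrightarrow> f n \<in> \<F>"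
    and nlp: "\<not> limit_point_type (compseq moeb_app f)"
  obtains q p N where "q \<in> cball 0 1" "p \<noteq> q"
    "\<And>n. n \<ge> N \<Longrightarrow> cmod (alpha (f n)) = 1 \<and> compseq moeb_app f n (alpha (f n)) = p"
    "\<And>e \<delta>. e > 0 \<Longrightarrow> \<delta> > 0 \<Longrightarrow> \<exists>K. \<forall>n\<ge>K. \<forall>z\<in>cball 0 1. dist z (alpha (f n)) \<ge> e \<longrightarrow>
       dist (compseq moeb_app f n z) q < \<delta>"
proof -
  have fMD: "\<And>n. n \<ge> 1 \<Longrightarrow> f n \<in> MD" using f sub by blast
  obtain N' where N': "\<And>n. n > N' \<Longrightarrow> cmod (alpha (f n)) = 1"
    "\<And>n. n > N' \<Longrightarrow> moeb_app (f (Suc n)) (alpha (f (Suc n))) = alpha (f n)"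
    using eventually_tangent_chain[of \<F> f, OF fin sub f nlp] by blast
  \<comment> \<open>The shift by one makes \<open>g 0 = f N\<close> tangent as well, as its tangency
    point normalises the whole tail.\<close>
  define N where "N = Suc N'"
  define g where "g k = f (N + k)" for k
  define a where "a k = alpha (g k)" for k
  have g: "g k \<in> \<F>" "cmod (alpha (g k)) = 1"
    "moeb_app (g (Suc k)) (alpha (g (Suc k))) = alpha (g k)" for k
    using f[of "N + k"] N'[of "N + k"] unfolding g_def N_def by simp_all
  have gMD: "\<And>k. g k \<in> MD" using g(1) sub by blast
  have a1: "cmod (a k) = 1" "a k \<in> cball 0 1" "a k \<noteq> 0" for k using g(2)[of k] unfolding a_def by auto
  let ?F = "compseq moeb_app f N" and ?G = "compseq moeb_app g"
  have FG: "compseq moeb_app f (N + k) z = ?F (?G k z)" for k z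
    unfolding compseq_add g_def[abs_def, symmetric] by simp
  have Gmaps: "?G k z \<in> cball 0 1" if "z \<in> cball 0 1" for k z
    by (rule compseq_maps[of g, OF gMD that])
  have contF: "continuous_on (cball 0 1) ?F" by (rule compseq_continuous_on[of f, OF fMD])
  obtain \<kappa> :: "nat \<Rightarrow> real" and \<mu> :: "nat \<Rightarrow> complex" and \<epsilon> M :: real where
    eps: "\<epsilon> > 0" and mu0: "\<mu> 0 = 0" and lam: "\<And>k. \<kappa> k > 0"
    and mu: "\<And>k. Re (\<mu> (Suc k) - \<mu> k) \<ge> \<epsilon> * \<kappa> k" "\<And>k. cmod (\<mu> (Suc k) - \<mu> k) \<le> M * \<kappa> k"
    and Ga: "\<And>k. ?G k (a k) = a 0"
    and aff: "\<And>k z. z \<in> cball 0 1 \<Longrightarrow> z \<noteq> a k \<Longrightarrow>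
       ?G k z \<noteq> a 0 \<and> cayley (a 0) (?G k z) = of_real (\<kappa> k) * cayley (a k) z + \<mu> k"
    by (rule tangent_chain_affine[of \<F> g, OF fin sub g, folded a_def]) (erule that, assumption+)
  have bounded_Re: "\<exists>C. \<forall>k. Re (\<mu> k) \<le> C"
  proof (rule ccontr)
    assume unb: "\<nexists>C. \<forall>k. Re (\<mu> k) \<le> C"
    have "limit_point_type (compseq moeb_app f)"
    proof (rule limit_point_typeI[of f, OF fMD])
      fix e :: real assume e: "e > 0"
      then obtain d where d: "d > 0" "\<And>x. x \<in> cball 0 1 \<Longrightarrow> dist x (a 0) < d \<Longrightarrow> dist (?F x) (?F (a 0)) < e / 2"
        using contF[unfolded continuous_on_iff, rule_format, OF a1(2)[of 0] half_gt_zero[OF e]] by blast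
      \<comment> \<open>The numerator 3 against the bound \<open>2 / C\<close> leaves
        \<open>2 * d / 3\<close>, strictly below \<open>d\<close>.\<close>
      obtain k where k: "Re (\<mu> k) > 3 / d" using unb by (meson linorder_not_le)
      have d3: "3 / d > 0" using d by simp
      have near: "dist (?G k z) (a 0) < d" if z: "z \<in> cball 0 1" for z
      proof (cases "z = a k")
        case True
        then show ?thesis using Ga[of k] d by simp
      next
        case False
        have "Re (cayley (a 0) (?G k z)) = \<kappa> k * Re (cayley (a k) z) + Re (\<mu> k)"
          using aff[OF z False] by simp
        moreover have "0 \<le> \<kappa> k * Re (cayley (a k) z)"
          using lam[of k] Re_cayley_nonneg[OF a1(1) z] by simp
        ultimately have "Re (cayley (a 0) (?G k z)) \<ge> 3 / d" using k by linarith
        then have "dist (?G k z) (a 0) \<le> 2 / (3 / d)"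
          by (intro dist_le_Re_cayley[OF a1(1)] conjunct1[OF aff[OF z False]] d3)
        also have "\<dots> < d" using d by simp
        finally show ?thesis .
      qed
      have "dist (compseq moeb_app f (N + k) z) (compseq moeb_app f (N + k) w) < e"
        if "z \<in> cball 0 1" "w \<in> cball 0 1" for z w
        unfolding FG
        by (rule dist_triangle_half_l[OF d(2)[OF Gmaps[OF that(1)] near[OF that(1)]]
              d(2)[OF Gmaps[OF that(2)] near[OF that(2)]]])
      then show "\<exists>n. \<forall>z\<in>cball 0 1. \<forall>w\<in>cball 0 1.
           dist (compseq moeb_app f n z) (compseq moeb_app f n w) < e" by blast
    qed
    then show False using nlp by blast
  qed
  then obtain C where C: "\<And>k. Re (\<mu> k) \<le> C" by blast
  have "summable \<kappa>"
  proof (rule bounded_imp_summable)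
    show "0 \<le> \<kappa> k" for k using lam[of k] by simp
    fix n
    have "\<epsilon> * (\<Sum>k\<le>n. \<kappa> k) = (\<Sum>k<Suc n. \<epsilon> * \<kappa> k)" by (simp only: sum_distrib_left lessThan_Suc_atMost)
    also have "\<dots> \<le> (\<Sum>k<Suc n. Re (\<mu> (Suc k)) - Re (\<mu> k))" using mu(1) by (intro sum_mono) simp
    also have "\<dots> = Re (\<mu> (Suc n))" using sum_lessThan_telescope[of "\<lambda>k. Re (\<mu> k)" "Suc n"] by (simp only: mu0 zero_complex.sel diff_0_right)
    also have "\<dots> \<le> C" by (rule C)
    finally show "(\<Sum>k\<le>n. \<kappa> k) \<le> C / \<epsilon>" using eps by (simp add: field_simps)
  qed
  then have lam0: "\<kappa> \<longlonglongrightarrow> 0" by (rule summable_LIMSEQ_zero)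
  have "summable (\<lambda>k. M * \<kappa> k)" using \<open>summable \<kappa>\<close> by (rule summable_mult)
  then have "summable (\<lambda>k. \<mu> (Suc k) - \<mu> k)"
    by (rule summable_comparison_test'[of _ 0]) (rule mu(2))
  then have "convergent (\<lambda>n. \<Sum>k<n. \<mu> (Suc k) - \<mu> k)" by (simp add: summable_iff_convergent)
  then have "convergent \<mu>" unfolding sum_lessThan_telescope mu0 by simp
  then obtain \<nu> where nu: "\<mu> \<longlonglongrightarrow> \<nu>" by (auto simp: convergent_def)
  \<comment> \<open>This puts \<open>b\<close> strictly inside the disc, away from the boundary
    point \<open>a 0\<close>; injectivity of \<open>?F\<close> then separates \<open>q\<close> from
    the image of \<open>a 0\<close>.\<close>
  have Re_nu: "Re \<nu> > 0"
  proof -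
    have inc: "Re (\<mu> k) \<le> Re (\<mu> (Suc k))" for k
      using mu(1)[of k] mult_pos_pos[OF eps lam[of k]] by simp
    have incseq: "incseq (\<lambda>k. Re (\<mu> k))" using inc by (rule incseq_SucI)
    have "Re (\<mu> 1) > 0" using mu(1)[of 0] mult_pos_pos[OF eps lam[of 0]] by (simp add: mu0)
    also have "Re (\<mu> 1) \<le> Re \<nu>"
    proof (rule LIMSEQ_le_const)
      show "(\<lambda>k. Re (\<mu> k)) \<longlonglongrightarrow> Re \<nu>" using nu by (rule tendsto_Re)
      show "\<exists>N. \<forall>n\<ge>N. Re (\<mu> 1) \<le> Re (\<mu> n)"
        using incseqD[OF incseq, of 1] by blast
    qed
    finally show ?thesis .
  qed
  define b where "b = cayley_inv (a 0) \<nu>"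
  define q where "q = ?F b"
  have b: "b \<in> ball 0 1" unfolding b_def by (rule cayley_inv_in_ball[OF a1(1) Re_nu])
  then have b': "b \<in> cball 0 1" by simp
  have "a 0 \<noteq> b" using b a1(1)[of 0] by auto
  then have pq: "?F (a 0) \<noteq> q"
    unfolding q_def using inj_onD[OF compseq_inj_on[of f N, OF fMD] _ a1(2) b'] by blast
  show thesis
  proof (rule that[of q "?F (a 0)" N])
    show "q \<in> cball 0 1" unfolding q_def by (rule compseq_maps[of f, OF fMD b'])
    show "?F (a 0) \<noteq> q" by (rule pq)
    show "cmod (alpha (f n)) = 1 \<and> compseq moeb_app f n (alpha (f n)) = ?F (a 0)" if n: "n \<ge> N" for n
    proof -
      obtain k where k: "n = N + k" using n le_Suc_ex by blast
      show ?thesis using g(2)[of k] FG[of k "a k"] Ga[of k] unfolding k a_def g_def by simp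
    qed
    fix e \<delta> :: real assume e: "e > 0" and "\<delta> > 0"
    then obtain d1 where d1: "d1 > 0" "\<And>x. x \<in> cball 0 1 \<Longrightarrow> dist x b < d1 \<Longrightarrow> dist (?F x) q < \<delta>"
      using contF[unfolded continuous_on_iff, rule_format, OF b'] unfolding q_def by blast
    have "\<nu> + 1 \<noteq> 0" using Re_nu by (auto simp: complex_eq_iff)
    then have "isCont (cayley_inv (a 0)) \<nu>"
      unfolding cayley_inv_def[abs_def] by (intro continuous_intros)
    then obtain d2 where d2: "d2 > 0" "\<And>w. dist w \<nu> < d2 \<Longrightarrow> dist (cayley_inv (a 0) w) b < d1"
      unfolding continuous_at_eps_delta b_def using d1(1) by blast
    \<comment> \<open>At distance at least \<open>e\<close> from the tangency point the Cayley
      coordinate is at most \<open>2 / e\<close>, so the linear term dies with \<kappa>, uniformly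
      in \<open>z\<close>.\<close>
    have "(\<lambda>k. \<kappa> k * (2 / e) + dist (\<mu> k) \<nu>) \<longlonglongrightarrow> 0 * (2 / e) + dist \<nu> \<nu>"
      by (intro tendsto_intros lam0 nu)
    then have "\<forall>\<^sub>F k in sequentially. \<kappa> k * (2 / e) + dist (\<mu> k) \<nu> < d2"
      by (rule order_tendstoD(2)) (use d2(1) in simp)
    then obtain K where K: "\<And>k. k \<ge> K \<Longrightarrow> \<kappa> k * (2 / e) + dist (\<mu> k) \<nu> < d2"
      unfolding eventually_sequentially by blast
    have "dist (compseq moeb_app f n z) q < \<delta>"
      if n: "n \<ge> N + K" and z: "z \<in> cball 0 1" "dist z (alpha (f n)) \<ge> e" for n z
    proof -
      obtain k where k: "n = N + k" "k \<ge> K" using n le_Suc_ex[of N n] by auto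
      have az: "dist z (a k) \<ge> e" using z(2) unfolding k a_def g_def .
      then have ne: "z \<noteq> a k" using e by auto
      note G = aff[OF z(1) ne]
      have cz: "cmod (cayley (a k) z) \<le> 2 / e"
        using cmod_cayley_le[OF a1(1) _ e az] z(1) by simp
      have "cmod (of_real (\<kappa> k) * cayley (a k) z) \<le> \<kappa> k * (2 / e)"
        unfolding norm_mult norm_of_real
        using mult_left_mono[OF cz less_imp_le[OF lam[of k]]] lam[of k] by simp
      moreover have "dist (cayley (a 0) (?G k z)) \<nu>
          \<le> cmod (of_real (\<kappa> k) * cayley (a k) z) + dist (\<mu> k) \<nu>"
        using G norm_triangle_ineq[of "of_real (\<kappa> k) * cayley (a k) z" "\<mu> k - \<nu>"]
        by (simp add: dist_norm add_diff_eq)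
      ultimately have "dist (cayley (a 0) (?G k z)) \<nu> < d2" using K[OF k(2)] by linarith
      then have "dist (cayley_inv (a 0) (cayley (a 0) (?G k z))) b < d1" by (rule d2(2))
      then have "dist (?G k z) b < d1" using cayley_inv_cayley[OF a1(3) conjunct1[OF G]] by (simp only:)
      then show ?thesis unfolding k FG by (rule d1(2)[OF Gmaps[OF z(1)]])
    qed
    then show "\<exists>K. \<forall>n\<ge>K. \<forall>z\<in>cball 0 1. dist z (alpha (f n)) \<ge> e \<longrightarrow>
       dist (compseq moeb_app f n z) q < \<delta>" by blast
  qed
qed

section \<open>Recurrent maps and assembly of the two cases\<close>

lemma exists_antipodal_pair_avoiding:
  assumes "finite (X :: complex set)"
  obtains u where "cmod u = 1" "u \<notin> X" "- u \<notin> X"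
proof -
  have "connected (sphere (0::complex) 1)" by (intro connected_sphere) simp
  then have "infinite (sphere (0::complex) 1)"
  proof (subst connected_finite_iff_sing)
    have "1 \<in> sphere (0::complex) 1" "-1 \<in> sphere (0::complex) 1" "(1::complex) \<noteq> -1" by simp_all
    then show "\<not> (sphere (0::complex) 1 = {} \<or> (\<exists>a. sphere (0::complex) 1 = {a}))"
      by (metis empty_iff singletonD)
  qed
  moreover have "finite (X \<union> uminus ` X)" using assms by simp
  ultimately obtain u where "u \<in> sphere 0 1" "u \<notin> X \<union> uminus ` X"
    by (metis finite_subset subsetI)
  then show thesis using that[of u] by (force simp: image_iff)
qed

text \<open>Each of the finitely many maps that occur finitely often has a last occurrence;
  \<open>N\<close> lies beyond all of them. Past it, a tangency point \<open>alpha (f n)\<close> on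
  the circle belongs to \<open>X\<close>.\<close>

lemma recurrent_eventually:
  fixes f :: "nat \<Rightarrow> 'a"
  assumes "finite \<F>" "\<And>n. n \<ge> 1 \<Longrightarrow> f n \<in> \<F>"
  obtains N where "N \<ge> 1" "\<And>n. n \<ge> N \<Longrightarrow> infinite {k. k \<ge> 1 \<and> f k = f n}"
proof -
  let ?B = "{g \<in> \<F>. finite {k. k \<ge> 1 \<and> f k = g}}"
  have "finite (\<Union>g\<in>?B. {k. k \<ge> 1 \<and> f k = g})" using assms(1) by (intro finite_UN_I) auto
  from iffD1[OF finite_nat_set_iff_bounded this]
  obtain N where N: "\<forall>n\<in>(\<Union>g\<in>?B. {k. k \<ge> 1 \<and> f k = g}). n < N" ..
  show thesis
  proof (rule that[of "Suc N"])
    fix n assume n: "n \<ge> Suc N"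
    show "infinite {k. k \<ge> 1 \<and> f k = f n}"
    proof
      assume "finite {k. k \<ge> 1 \<and> f k = f n}"
      then have "n \<in> (\<Union>g\<in>?B. {k. k \<ge> 1 \<and> f k = g})" using assms(2)[of n] n by auto
      then have "n < N" using N by (rule_tac bspec)
      then show False using n by linarith
    qed
  qed simp
qed

theorem theorem1p6:
  fixes \<F> :: "moeb set" and f :: "nat \<Rightarrow> moeb"
  assumes "finite \<F>" and "\<F> \<subseteq> MD" and "\<And>n. n \<ge> 1 \<Longrightarrow> f n \<in> \<F>"
  defines "X \<equiv> {alpha g | g. g \<in> \<F> \<and> alpha g \<in> sphere 0 1 \<and> infinite {n. n \<ge> 1 \<and> f n = g}}"
  shows "\<exists>q\<in>cball 0 1.
           conv_ideally (compseq poinc f) q \<and>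
           loc_unif_chordal (compseq moeb_app f) q (cball 0 1 - X) \<and>
           (\<forall>x\<in>X. ((\<lambda>n. chordal (compseq moeb_app f n x) q) \<longlonglongrightarrow> 0)
                    \<longleftrightarrow> limit_point_type (compseq moeb_app f))"
proof -
  let ?F = "compseq moeb_app f"
  have fMD: "\<And>n. n \<ge> 1 \<Longrightarrow> f n \<in> MD" using assms(2,3) by blast
  have "X \<subseteq> alpha ` \<F>" unfolding X_def by blast
  then have finX: "finite X" using assms(1) finite_surj by blast
  have X1: "x \<in> cball 0 1" if "x \<in> X" for x using that unfolding X_def by auto
  have chordal_lim: "(\<lambda>n. chordal (?F n x) q) \<longlonglongrightarrow> 0" if "(\<lambda>n. ?F n x) \<longlonglongrightarrow> q" for x q
  proof (rule Lim_null_comparison)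
    show "\<forall>\<^sub>F n in sequentially. norm (chordal (?F n x) q) \<le> 2 * dist (?F n x) q"
      using chordal_le by (intro always_eventually allI) (simp add: chordal_def)
    have "(\<lambda>n. 2 * dist (?F n x) q) \<longlonglongrightarrow> 2 * dist q q" using that by (intro tendsto_intros) simp
    then show "(\<lambda>n. 2 * dist (?F n x) q) \<longlonglongrightarrow> 0" by simp
  qed
  show ?thesis
  proof (cases "limit_point_type ?F")
    case True
    then obtain q where q: "(\<Inter>n. ?F n ` cball 0 1) = {q}" unfolding limit_point_type_def by blast
    then have "q \<in> ?F 0 ` cball 0 1" by blast
    then have q1: "q \<in> cball 0 1" by simp
    have unif: "\<exists>N. \<forall>n\<ge>N. \<forall>z\<in>cball 0 1. dist (?F n z) q < e" if e: "e > 0" for e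
    proof -
      obtain N where "\<And>n z. n \<ge> N \<Longrightarrow> z \<in> cball 0 1 \<Longrightarrow> dist (?F n z) q < e"
        using limit_point_type_uniform[of f, OF fMD q e] by blast
      then show ?thesis by blast
    qed
    have lim: "(\<lambda>n. ?F n z) \<longlonglongrightarrow> q" if "z \<in> cball 0 1" for z
      unfolding lim_sequentially using unif that by blast
    have "conv_ideally (compseq poinc f) q"
      by (rule conv_ideally_if_antipodal[of f, OF fMD, where u = 1]) (simp_all add: lim)
    moreover have "loc_unif_chordal ?F q (cball 0 1 - X)"
      unfolding loc_unif_chordal_def
    \<comment> \<open>Any radius would do: convergence is uniform on the whole closed disc.\<close>
    proof (intro ballI exI[of _ "1::real"] conjI allI impI)
      fix \<epsilon> :: real assume "\<epsilon> > 0"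
      then obtain N where N: "\<forall>n\<ge>N. \<forall>z\<in>cball 0 1. dist (?F n z) q < \<epsilon> / 2"
        using unif[of "\<epsilon> / 2"] by auto
      have "chordal (?F n z) q < \<epsilon>" if "n \<ge> N" "z \<in> cball 0 1" for n z
      proof -
        have "dist (?F n z) q < \<epsilon> / 2" using N that by blast
        then show ?thesis using chordal_le[of "?F n z" q] by linarith
      qed
      then show "\<exists>N. \<forall>n\<ge>N. \<forall>z\<in>(cball 0 1 - X) \<inter> ball x 1. chordal (?F n z) q < \<epsilon>" for x by blast
    qed simp
    moreover have "(\<lambda>n. chordal (?F n x) q) \<longlonglongrightarrow> 0" if "x \<in> X" for x
      using chordal_lim lim X1[OF that] by blast
    ultimately show ?thesis using q1 True by blast
  next
    case False
    obtain q p N where q: "q \<in> cball 0 1" "p \<noteq> q"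
      and tan: "\<And>n. n \<ge> N \<Longrightarrow> cmod (alpha (f n)) = 1 \<and> ?F n (alpha (f n)) = p"
      and conv: "\<And>e \<delta>. e > 0 \<Longrightarrow> \<delta> > 0 \<Longrightarrow> \<exists>K. \<forall>n\<ge>K. \<forall>z\<in>cball 0 1. dist z (alpha (f n)) \<ge> e \<longrightarrow>
       dist (?F n z) q < \<delta>"
      by (rule limit_disc_convergence[of \<F> f, OF assms(1,2,3) False]) (assumption, erule that, assumption+)
    obtain N' where N': "N' \<ge> 1" "\<And>n. n \<ge> N' \<Longrightarrow> infinite {k. k \<ge> 1 \<and> f k = f n}"
      by (rule recurrent_eventually[of \<F> f, OF assms(1,3)]) (assumption, erule that, assumption)
    have inX: "alpha (f n) \<in> X" if "n \<ge> N + N'" for n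
    proof -
      have "f n \<in> \<F>" "alpha (f n) \<in> sphere 0 1" "infinite {k. k \<ge> 1 \<and> f k = f n}"
        using assms(3)[of n] tan[of n] N'(1) N'(2)[of n] that by simp_all
      then show ?thesis unfolding X_def by blast
    qed
    have locunif: "\<exists>e>0. \<forall>\<delta>>0. \<exists>K. \<forall>n\<ge>K. \<forall>z\<in>cball 0 1 \<inter> ball x e. dist (?F n z) q < \<delta>"
      if x: "x \<notin> X" for x
    proof -
      \<comment> \<open>Finiteness of \<open>X\<close> gives a positive distance from
        \<open>x\<close>. Within \<open>d / 2\<close> of \<open>x\<close>, every point stays at
        least \<open>d / 2\<close> away from all late tangency points, since these lie in
        \<open>X\<close>.\<close>
      obtain d where d: "d > 0" "\<And>y. y \<in> X \<Longrightarrow> d \<le> dist x y"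
        using finite_set_avoid[OF finX, of x] x by metis
      have "\<exists>K. \<forall>n\<ge>K. \<forall>z\<in>cball 0 1 \<inter> ball x (d / 2). dist (?F n z) q < \<delta>" if "\<delta> > 0" for \<delta>
      proof -
        obtain K where K: "\<And>n z. n \<ge> K \<Longrightarrow> z \<in> cball 0 1 \<Longrightarrow> dist z (alpha (f n)) \<ge> d / 2 \<Longrightarrow>
            dist (?F n z) q < \<delta>"
          using conv[OF half_gt_zero[OF d(1)] \<open>\<delta> > 0\<close>] by blast
        have "dist (?F n z) q < \<delta>" if n: "n \<ge> K + N + N'" and z: "z \<in> cball 0 1 \<inter> ball x (d / 2)" for n z
        proof -
          have "d \<le> dist x (alpha (f n))" using d(2) inX n by simp
          moreover have "dist x z < d / 2" using z by simp
          ultimately have "dist z (alpha (f n)) \<ge> d / 2"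
            using dist_triangle[of x "alpha (f n)" z] by linarith
          then show ?thesis using K n z by auto
        qed
        then show ?thesis by blast
      qed
      then show ?thesis using d(1) half_gt_zero by blast
    qed
    have "loc_unif_chordal ?F q (cball 0 1 - X)"
      unfolding loc_unif_chordal_def
    proof
      fix x assume "x \<in> cball 0 1 - X"
      then obtain e where e: "e > 0"
        "\<And>\<delta>. \<delta> > 0 \<Longrightarrow> \<exists>K. \<forall>n\<ge>K. \<forall>z\<in>cball 0 1 \<inter> ball x e. dist (?F n z) q < \<delta>"
        using locunif[of x] by auto
      have "\<exists>K. \<forall>n\<ge>K. \<forall>z\<in>(cball 0 1 - X) \<inter> ball x e. chordal (?F n z) q < \<epsilon>" if "\<epsilon> > 0" for \<epsilon>
      proof -
        obtain K where K: "\<forall>n\<ge>K. \<forall>z\<in>cball 0 1 \<inter> ball x e. dist (?F n z) q < \<epsilon> / 2"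
          using e(2)[OF half_gt_zero[OF \<open>\<epsilon> > 0\<close>]] by blast
        have "chordal (?F n z) q < \<epsilon>" if "n \<ge> K" "z \<in> (cball 0 1 - X) \<inter> ball x e" for n z
        proof -
          have "dist (?F n z) q < \<epsilon> / 2" using K that by blast
          then show ?thesis using chordal_le[of "?F n z" q] by linarith
        qed
        then show ?thesis by blast
      qed
      then show "\<exists>e>0. \<forall>\<epsilon>>0. \<exists>N. \<forall>n\<ge>N. \<forall>z\<in>(cball 0 1 - X) \<inter> ball x e. chordal (?F n z) q < \<epsilon>"
        using e(1) by blast
    qed
    moreover have "conv_ideally (compseq poinc f) q"
    proof -
      \<comment> \<open>Both ends of the geodesic through \<open>j\<close> must avoid
        \<open>X\<close>, so that both image endpoints tend to \<open>q\<close>.\<close>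
      obtain u where u: "cmod u = 1" "u \<notin> X" "- u \<notin> X"
        using exists_antipodal_pair_avoiding[OF finX] by blast
      have lim: "(\<lambda>n. ?F n v) \<longlonglongrightarrow> q" if v: "cmod v = 1" "v \<notin> X" for v
      proof -
        obtain e where e: "e > 0" "\<forall>\<delta>>0. \<exists>K. \<forall>n\<ge>K. \<forall>z\<in>cball 0 1 \<inter> ball v e. dist (?F n z) q < \<delta>"
          using locunif[OF v(2)] by blast
        have "v \<in> cball 0 1 \<inter> ball v e" using v(1) e(1) by simp
        then show ?thesis unfolding lim_sequentially using e(2) by blast
      qed
      show ?thesis
        by (rule conv_ideally_if_antipodal[of f, OF fMD u(1)]) (use lim u in simp_all)
    qed
    moreover have "\<not> (\<lambda>n. chordal (?F n x) q) \<longlonglongrightarrow> 0" if "x \<in> X" for x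
    proof
      assume lim: "(\<lambda>n. chordal (?F n x) q) \<longlonglongrightarrow> 0"
      obtain g where g: "x = alpha g" "infinite {n. n \<ge> 1 \<and> f n = g}"
        using \<open>x \<in> X\<close> unfolding X_def by blast
      have "dist p q > 0" using q(2) by simp
      then have "\<forall>\<^sub>F n in sequentially. chordal (?F n x) q < dist p q"
        by (rule order_tendstoD(2)[OF lim])
      then obtain K where K: "\<And>n. n \<ge> K \<Longrightarrow> chordal (?F n x) q < dist p q"
        unfolding eventually_sequentially by blast
      \<comment> \<open>The map with tangency point \<open>x\<close> recurs, and at each late
        recurrence \<open>?F n x\<close> equals \<open>p\<close>, at fixed positive distance from
        \<open>q\<close>.\<close>
      obtain n where n: "n > K + N" "f n = g"
        using g(2) unfolding infinite_nat_iff_unbounded by blast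
      have "?F n x = p" using tan[of n] n g(1) by simp
      moreover have "dist (?F n x) q \<le> chordal (?F n x) q"
        using dist_le_chordal[OF compseq_maps[of f, OF fMD X1[OF that]] q(1)] by blast
      ultimately show False using K[of n] n(1) by simp
    qed
    ultimately show ?thesis using q(1) False by blast
  qed
qed

end
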